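(* Let $\phi=\phi(x,t,\theta)$ be a fermionic (odd) superfield evolving according to the supersymmetric Sawada-Kotera equation $$\phi_{t}+\phi_{xxxxx}+5\phi_{xxx}(\mathcal{D}\phi)+5\phi_{xx}(\mathcal{D}\phi_x)+5\phi_x(\mathcal{D}\phi)^2=0,$$ and let $L=(\mathcal{D}^3+\phi)(\mathcal{D}^3+\phi)$. Then for every positive integer $n$, $$\frac{\partial}{\partial t}L^{\frac{n}{6}}=\left[\,9\,(L^{\frac{5}{3}})_+,\;L^{\frac{n}{6}}\right],$$ and consequently the super residue of $L^{n/6}$ is a conserved density: $\frac{\partial}{\partial t}\,\mathrm{sres}\,L^{\frac{n}{6}}\in\mathrm{Im}\,\mathcal{D}$, so that $\int \mathrm{sres}\,L^{\frac{n}{6}}\,\mathrm{d}x\,\mathrm{d}\theta$ is a conserved quantity.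
   Context: Superspace has one even coordinate $x$ and one odd coordinate $\theta$; $\mathcal{D}=\partial_\theta+\theta\partial_x$ is the super derivative, so $\mathcal{D}^2=\partial_x$. Let $\mathcal{A}$ be the algebra of super differential polynomials in $\phi$: the free supercommutative algebra generated by $\mathcal{D}^k\phi$, $k\ge 0$, with $\phi$ odd (so $\mathcal{D}^k\phi$ has parity $k+1$ mod 2) and $\mathcal{D}$ acting as an odd derivation. $(\mathcal{D}f)$ with parentheses denotes $\mathcal{D}$ applied to $f$, $f_x=(\mathcal{D}^2f)$, and $\mathrm{Im}\,\mathcal{D}$ is the image of $\mathcal{D}:\mathcal{A}\to\mathcal{A}$. The integral $\int\cdot\,\mathrm{d}x\,\mathrm{d}\theta$ is formal and vanishes on $\mathrm{Im}\,\mathcal{D}$. Super pseudodifferential operators are formal series $\sum_{k\le N}a_k\mathcal{D}^k$ with $a_k\in\mathcal{A}$, composed using $\mathcal{D}a=(\mathcal{D}a)+(-1)^{|a|}a\mathcal{D}$; $(\cdot)_+$ is the projection to the differential part (terms with $k\ge0$), and $\mathrm{sres}$ denotes the coefficient of $\mathcal{D}^{-1}$. The supercommutator is $[A,B]=AB-(-1)^{|A||B|}BA$. There is a unique odd operator $\Lambda=\mathcal{D}+\mathrm{O}(1)$ with coefficients in $\mathcal{A}$ such that $\Lambda^3=\mathcal{D}^3+\phi$; then $L=\Lambda^6$ and one sets $L^{n/6}=\Lambda^n$ (in particular $L^{5/3}=\Lambda^{10}$). The time derivative $\partial/\partial t$ is the even derivation of $\mathcal{A}$ commuting with $\mathcal{D}$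 determined by the evolution equation for $\phi$, applied to operators coefficientwise. *)

theory Defs
  imports Complex_Main "HOL-Library.Multiset" "HOL-Library.FSet" "HOL-Library.Poly_Mapping"
begin

section \<open>Super differential polynomials\<close>

text \<open>
  The generator \<open>\<D>\<^sup>k\<phi>\<close> is odd (fermionic) for even \<open>k\<close> and even (bosonic) for odd \<open>k\<close>.  A monomial
  is a pair \<open>(B, F)\<close>: the multiset \<open>B\<close> lists the bosonic factors, \<open>i\<close> standing for
  \<open>\<D>\<^sup>2\<^sup>i\<^sup>+\<^sup>1\<phi>\<close>, and the finite set \<open>F\<close> the fermionic factors, \<open>i\<close> standing for \<open>\<D>\<^sup>2\<^sup>i\<phi>\<close> and
  multiplied in increasing order.  These monomials are a basis of the free supercommutative algebra.
\<close>

type_synonym smono = "nat multiset \<times> nat fset"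

typedef (overloaded) ('k::zero) sdpoly = "UNIV :: (smono \<Rightarrow>\<^sub>0 'k) set"
  by auto

setup_lifting type_definition_sdpoly

lift_definition mcoeff :: "'k::zero sdpoly \<Rightarrow> smono \<Rightarrow> 'k" is Poly_Mapping.lookup .

lift_definition support :: "'k::zero sdpoly \<Rightarrow> smono set" is Poly_Mapping.keys .

lift_definition monom :: "smono \<Rightarrow> 'k::{zero,one} sdpoly" is "\<lambda>m. Poly_Mapping.single m 1" .

lift_definition scal :: "'k::mult_zero \<Rightarrow> 'k sdpoly \<Rightarrow> 'k sdpoly" (infixr "\<cdot>" 75)
  is "\<lambda>c. Poly_Mapping.map (\<lambda>x. c * x)" .

instantiation sdpoly :: (ab_group_add) ab_group_add
begin
lift_definition zero_sdpoly :: "'a sdpoly" is 0 .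
lift_definition plus_sdpoly :: "'a sdpoly \<Rightarrow> 'a sdpoly \<Rightarrow> 'a sdpoly" is "(+)" .
lift_definition uminus_sdpoly :: "'a sdpoly \<Rightarrow> 'a sdpoly" is uminus .
lift_definition minus_sdpoly :: "'a sdpoly \<Rightarrow> 'a sdpoly \<Rightarrow> 'a sdpoly" is "(-)" .
instance by standard (transfer, simp add: algebra_simps)+
end

lemma sdpoly_eqI: "(\<And>m. mcoeff f m = mcoeff g m) \<Longrightarrow> f = g"
  by transfer (rule poly_mapping_eqI)

lemma finite_support [simp]: "finite (support f)"
  by transfer simp

lemma in_support_iff: "m \<in> support f \<longleftrightarrow> mcoeff f m \<noteq> 0"
  by transfer (simp add: in_keys_iff)

lemma mcoeff_simps [simp]:
  "mcoeff 0 m = 0" "mcoeff (f + g) m = mcoeff f m + mcoeff g m"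
  "mcoeff (- f) m = - mcoeff f m" "mcoeff (f - g) m = mcoeff f m - mcoeff g m"
  by (transfer, simp add: lookup_add lookup_minus)+

lemma mcoeff_scal [simp]: "mcoeff (c \<cdot> f) m = c * mcoeff f m"
  by transfer (simp add: map.rep_eq when_def)

lemma mcoeff_mono: "mcoeff (monom n) m = (if m = n then 1 else 0)"
  by transfer (simp add: lookup_single when_def)

lemma mcoeff_sum: "mcoeff (\<Sum>x\<in>A. h x) m = (\<Sum>x\<in>A. mcoeff (h x) m)"
  by (induction A rule: infinite_finite_induct) auto

lemma scal_simps [simp]:
  fixes c :: "'k::comm_ring_1"
  shows "c \<cdot> (f + g) = c \<cdot> f + c \<cdot> g" "c \<cdot> (f - g) = c \<cdot> f - c \<cdot> g" "c \<cdot> (- f) = - (c \<cdot> f)"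
    "(c + d) \<cdot> f = c \<cdot> f + d \<cdot> f" "(- c) \<cdot> f = - (c \<cdot> f)"
    "c \<cdot> d \<cdot> f = (c * d) \<cdot> f" "1 \<cdot> f = f" "0 \<cdot> f = 0" "c \<cdot> 0 = (0 :: 'k sdpoly)"
  by (auto intro!: sdpoly_eqI simp: algebra_simps)

lemma scal_sum: "(c::'k::comm_ring_1) \<cdot> (\<Sum>x\<in>A. h x) = (\<Sum>x\<in>A. c \<cdot> h x)"
  by (induction A rule: infinite_finite_induct) auto

definition linext :: "(smono \<Rightarrow> 'k sdpoly) \<Rightarrow> 'k::comm_ring_1 sdpoly \<Rightarrow> 'k sdpoly" where
  "linext h f = (\<Sum>m\<in>support f. mcoeff f m \<cdot> h m)"

definition linear_sd :: "('k::comm_ring_1 sdpoly \<Rightarrow> 'k sdpoly) \<Rightarrow> bool" where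
  "linear_sd h \<longleftrightarrow> (\<forall>f g. h (f + g) = h f + h g) \<and> (\<forall>c f. h (c \<cdot> f) = c \<cdot> h f)"

lemma linext_superset:
  assumes "finite S" "support f \<subseteq> S"
  shows "linext h f = (\<Sum>m\<in>S. mcoeff f m \<cdot> h m)"
  unfolding linext_def using assms
  by (intro sum.mono_neutral_left) (auto simp: in_support_iff)

lemma linear_linext: "linear_sd (linext h)"
proof -
  have "linext h (f + g) = linext h f + linext h g" for f g
  proof -
    let ?S = "support f \<union> support g \<union> support (f + g)"
    have "linext h x = (\<Sum>m\<in>?S. mcoeff x m \<cdot> h m)" if "x \<in> {f, g, f + g}" for x
      using that by (intro linext_superset) auto
    then show ?thesis by (simp add: sum.distrib)
  qed
  moreover have "linext h (c \<cdot> f) = c \<cdot> linext h f" for c f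
  proof -
    have "linext h (c \<cdot> f) = (\<Sum>m\<in>support f. mcoeff (c \<cdot> f) m \<cdot> h m)"
      by (intro linext_superset) (auto simp: in_support_iff)
    then show ?thesis by (simp add: linext_def scal_sum)
  qed
  ultimately show ?thesis by (simp add: linear_sd_def)
qed

lemma linear_sdD:
  assumes "linear_sd h"
  shows "h (f + g) = h f + h g" "h (c \<cdot> f) = c \<cdot> h f" "h 0 = 0" "h (- f) = - h f"
    "h (f - g) = h f - h g" "h (\<Sum>x\<in>A. F x) = (\<Sum>x\<in>A. h (F x))"
proof -
  show add: "h (f + g) = h f + h g" and sc: "h (c \<cdot> f) = c \<cdot> h f" for f g c
    using assms by (auto simp: linear_sd_def)
  show z: "h 0 = 0" using sc[of 0 0] by simp
  show m: "h (- f) = - h f" for f using sc[of "-1" f] by simp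
  show "h (f - g) = h f - h g" using add[of f "- g"] by (simp add: m)
  show "h (\<Sum>x\<in>A. F x) = (\<Sum>x\<in>A. h (F x))"
    by (induction A rule: infinite_finite_induct) (auto simp: add z)
qed

lemma linext_mono [simp]: "linext h (monom m) = (h m :: 'k::comm_ring_1 sdpoly)"
proof -
  have "linext h (monom m) = (\<Sum>n\<in>{m}. mcoeff (monom m) n \<cdot> h n)"
    by (intro linext_superset) (auto simp: in_support_iff mcoeff_mono split: if_splits)
  then show ?thesis by (simp add: mcoeff_mono)
qed

lemma sdpoly_expand: "f = (\<Sum>m\<in>support f. mcoeff f m \<cdot> monom m)" for f :: "'k::comm_ring_1 sdpoly"
  by (rule sdpoly_eqI)
     (simp add: mcoeff_sum mcoeff_mono if_distrib[of "\<lambda>x. _ * x"] in_support_iff cong: if_cong)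

lemma linear_sd_eqI:
  assumes "linear_sd h" "linear_sd h'" "\<And>m. h (monom m) = h' (monom m)"
  shows "h f = h' f"
  by (subst (1 2) sdpoly_expand[of f]) (simp add: linear_sdD[OF assms(1)] linear_sdD[OF assms(2)] assms(3))

text \<open>
  Two monomials with a common fermionic factor multiply to zero; otherwise reordering the fermionic
  factors contributes one sign for each inversion.
\<close>

definition mono_sign :: "smono \<Rightarrow> smono \<Rightarrow> 'k::comm_ring_1" where
  "mono_sign m n = (if snd m |\<inter>| snd n = {||}
     then (- 1) ^ card {(i, j). i |\<in>| snd m \<and> j |\<in>| snd n \<and> j < i} else 0)"

definition mono_join :: "smono \<Rightarrow> smono \<Rightarrow> smono" where
  "mono_join m n = (fst m + fst n, snd m |\<union>| snd n)"

lemma finite_pairs [simp]: "finite {(i, j). i |\<in>| F \<and> j |\<in>| G \<and> P i j}"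
  by (rule finite_subset[of _ "fset F \<times> fset G"]) auto

lemma finite_elems [simp]: "finite {i. i |\<in>| F \<and> P i}"
  by (rule finite_subset[of _ "fset F"]) auto

lemma mono_join_assoc: "mono_join (mono_join l m) n = mono_join l (mono_join m n)"
  by (auto simp: mono_join_def)

lemma mono_sign_cocycle:
  "mono_sign l m * mono_sign (mono_join l m) n = mono_sign l (mono_join m n) * mono_sign m n"
proof (cases "snd l |\<inter>| snd m = {||} \<and> snd l |\<inter>| snd n = {||} \<and> snd m |\<inter>| snd n = {||}")
  case True
  let ?I = "\<lambda>m n :: smono. {(i, j). i |\<in>| snd m \<and> j |\<in>| snd n \<and> j < i}"
  have "?I (mono_join l m) n = ?I l n \<union> ?I m n" "?I l n \<inter> ?I m n = {}"
    "?I l (mono_join m n) = ?I l m \<union> ?I l n" "?I l m \<inter> ?I l n = {}"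
    using True by (auto simp: mono_join_def)
  then have "card (?I (mono_join l m) n) = card (?I l n) + card (?I m n)"
    "card (?I l (mono_join m n)) = card (?I l m) + card (?I l n)"
    by (simp_all add: card_Un_disjoint)
  then show ?thesis
    using True by (auto simp: mono_sign_def power_add mono_join_def inf_sup_distrib1 inf_sup_distrib2)
next
  case False
  then show ?thesis by (auto simp: mono_sign_def mono_join_def inf_sup_distrib1 inf_sup_distrib2)
qed

lemma mono_sign_empty [simp]: "mono_sign ({#}, {||}) m = 1" "mono_sign m ({#}, {||}) = 1"
  by (auto simp: mono_sign_def)

lemma mono_join_empty [simp]: "mono_join ({#}, {||}) m = m" "mono_join m ({#}, {||}) = m"
  by (auto simp: mono_join_def)

instantiation sdpoly :: (comm_ring_1) ring_1
begin

definition one_sdpoly :: "'a sdpoly" where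
  "1 = monom ({#}, {||})"

definition times_sdpoly :: "'a sdpoly \<Rightarrow> 'a sdpoly \<Rightarrow> 'a sdpoly" where
  "f * g = linext (\<lambda>m. linext (\<lambda>n. mono_sign m n \<cdot> monom (mono_join m n)) g) f"

lemma linear_times_left: "linear_sd (\<lambda>f. f * g :: 'a sdpoly)"
  by (simp add: times_sdpoly_def linear_linext)

lemma linear_times_right: "linear_sd (\<lambda>g. f * g :: 'a sdpoly)"
  unfolding linear_sd_def times_sdpoly_def linext_def[of _ f]
  by (simp add: linear_sdD[OF linear_linext] sum.distrib scal_sum mult.commute)

lemma mono_times_mono: "monom m * monom n = mono_sign m n \<cdot> (monom (mono_join m n) :: 'a sdpoly)"
  by (simp add: times_sdpoly_def)

lemma linear_comp: "linear_sd g \<Longrightarrow> linear_sd h \<Longrightarrow> linear_sd (\<lambda>x. g (h x :: 'a sdpoly))"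
  by (simp add: linear_sd_def)

instance
proof
  fix f g h :: "'a sdpoly"
  note L = linear_sdD[OF linear_times_left] and R = linear_sdD[OF linear_times_right]
  show "f * g * h = f * (g * h)"
  proof (rule linear_sd_eqI[of "\<lambda>f. f * g * h" "\<lambda>f. f * (g * h)"])
    fix l
    show "monom l * g * h = monom l * (g * h)"
    proof (rule linear_sd_eqI[of "\<lambda>g. monom l * g * h" "\<lambda>g. monom l * (g * h)"])
      fix m
      show "monom l * monom m * h = monom l * (monom m * h)"
      proof (rule linear_sd_eqI[of "\<lambda>h. monom l * monom m * h" "\<lambda>h. monom l * (monom m * h)"])
        fix n
        show "monom l * monom m * monom n = monom l * (monom m * monom n :: 'a sdpoly)"
          by (simp add: mono_times_mono L R mono_sign_cocycle mono_join_assoc mult.commute)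
      qed (auto intro: linear_comp linear_times_left linear_times_right)
    qed (auto intro: linear_comp[of "\<lambda>g. g * h"] linear_comp[of "\<lambda>g. monom l * g"] linear_times_left linear_times_right)
  qed (auto intro: linear_comp[of "\<lambda>g. g * h"] linear_times_left linear_times_right)
  have id: "linear_sd (\<lambda>f. f :: 'a sdpoly)" by (simp add: linear_sd_def)
  show "1 * f = f"
    by (rule linear_sd_eqI[of "\<lambda>f. 1 * f"])
       (auto simp: id linear_times_right one_sdpoly_def mono_times_mono)
  show "f * 1 = f"
    by (rule linear_sd_eqI[of "\<lambda>f. f * 1"])
       (auto simp: id linear_times_left one_sdpoly_def mono_times_mono)
  show "(f + g) * h = f * h + g * h" "f * (g + h) = f * g + f * h" by (simp_all add: L R)
  have "mcoeff (0 :: 'a sdpoly) ({#}, {||}) \<noteq> mcoeff 1 ({#}, {||})"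
    by (simp add: one_sdpoly_def mcoeff_mono)
  then show "(0 :: 'a sdpoly) \<noteq> 1" by metis
qed

end

lemmas times_linear = linear_sdD[OF linear_times_left] linear_sdD[OF linear_times_right]

lemma linear_id: "linear_sd (\<lambda>f. f)"
  by (simp add: linear_sd_def)

lemma linear_add: "linear_sd g \<Longrightarrow> linear_sd h \<Longrightarrow> linear_sd (\<lambda>x. g x + h x)"
  by (simp add: linear_sd_def algebra_simps)

lemma bilinear_sd_eqI:
  assumes "\<And>g. linear_sd (\<lambda>f. h f g)" "\<And>f. linear_sd (h f)"
    and "\<And>g. linear_sd (\<lambda>f. h' f g)" "\<And>f. linear_sd (h' f)"
    and "\<And>m n. h (monom m) (monom n) = h' (monom m) (monom n)"
  shows "h f g = h' f g"
proof (rule linear_sd_eqI[of "\<lambda>f. h f g" "\<lambda>f. h' f g"])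
  show "h (monom m) g = h' (monom m) g" for m
    by (rule linear_sd_eqI[of "h (monom m)" "h' (monom m)"]) (use assms in auto)
qed (use assms in auto)

definition gen :: "nat \<Rightarrow> 'k::comm_ring_1 sdpoly" where
  "gen k = monom (if even k then ({#}, {|k div 2|}) else ({#k div 2#}, {||}))"

abbreviation phi :: "'k::comm_ring_1 sdpoly" ("\<phi>") where
  "\<phi> \<equiv> gen 0"

text \<open>Component of parity \<open>p\<close> (mod 2), and the grading automorphism \<open>a \<mapsto> (-1)\<^sup>|\<^sup>a\<^sup>| a\<close>.\<close>

definition part :: "nat \<Rightarrow> 'k::comm_ring_1 sdpoly \<Rightarrow> 'k sdpoly" where
  "part p = linext (\<lambda>m. if even (p + fcard (snd m)) then monom m else 0)"

definition grad :: "'k::comm_ring_1 sdpoly \<Rightarrow> 'k sdpoly" where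
  "grad f = part 0 f - part 1 f"

text \<open>Left partial derivative with respect to \<open>\<D>\<^sup>k\<phi>\<close>.\<close>

definition pd :: "nat \<Rightarrow> 'k::comm_ring_1 sdpoly \<Rightarrow> 'k sdpoly" where
  "pd k = linext (\<lambda>(B, F).
     let i = k div 2 in
     if odd k then of_nat (count B i) \<cdot> monom (B - {#i#}, F)
     else if i |\<in>| F then (- 1) ^ card {j. j |\<in>| F \<and> j < i} \<cdot> monom (B, F |-| {|i|})
     else 0)"

definition evolutionary :: "(nat \<Rightarrow> 'k::comm_ring_1 sdpoly) \<Rightarrow> 'k sdpoly \<Rightarrow> 'k sdpoly" where
  "evolutionary v f = (\<Sum>k | pd k f \<noteq> 0. v k * pd k f)"

definition D :: "'k::comm_ring_1 sdpoly \<Rightarrow> 'k sdpoly" where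
  "D = evolutionary (\<lambda>k. gen (Suc k))"

lemma linear_part: "linear_sd (part p)"
  by (simp add: part_def linear_linext)

lemma linear_grad: "linear_sd grad"
  by (simp add: linear_sd_def grad_def linear_sdD[OF linear_part])

lemma linear_pd: "linear_sd (pd k)"
  by (simp add: pd_def linear_linext)

lemmas lin = linear_sdD(1,2)[OF linear_part] linear_sdD(1,2)[OF linear_grad]
  linear_sdD(1,2)[OF linear_pd] linear_sdD(1,2)[OF linear_times_left] linear_sdD(1,2)[OF linear_times_right]

lemma part_monom: "part p (monom m) = (if even (p + fcard (snd m)) then monom m else 0)"
  by (simp add: part_def)

lemma grad_monom: "grad (monom m) = (- 1) ^ fcard (snd m) \<cdot> monom m"
  by (simp add: grad_def part_monom)

lemma part_add_part: "part 0 f + part 1 f = f"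
  by (rule linear_sd_eqI[of "\<lambda>f. part 0 f + part 1 f"])
     (auto simp: part_monom intro: linear_add linear_part linear_id)

lemma grad_grad [simp]: "grad (grad f) = f"
  by (rule linear_sd_eqI[of "\<lambda>f. grad (grad f)"])
     (auto simp: grad_monom linear_sdD[OF linear_grad] power_mult_distrib[symmetric]
        intro: linear_comp linear_grad linear_id)

lemma grad_mult: "grad (f * g) = grad f * grad g"
proof (rule bilinear_sd_eqI[of "\<lambda>f g. grad (f * g)" "\<lambda>f g. grad f * grad g"])
  fix m n
  show "grad (monom m * monom n) = grad (monom m) * (grad (monom n) :: 'a sdpoly)"
  proof (cases "snd m |\<inter>| snd n = {||}")
    case True
    then have "fcard (snd m |\<union>| snd n) = fcard (snd m) + fcard (snd n)"
      using fcard_funion_finter[of "snd m" "snd n"] by simp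
    then show ?thesis
      by (simp add: mono_times_mono grad_monom times_linear linear_sdD[OF linear_grad]
          mono_join_def power_add ac_simps)
  next
    case False
    then show ?thesis
      by (simp add: mono_times_mono grad_monom times_linear linear_sdD[OF linear_grad] mono_sign_def)
  qed
qed (simp_all add: linear_sd_def lin)

abbreviation inv_count :: "nat fset \<Rightarrow> nat fset \<Rightarrow> nat" where
  "inv_count F G \<equiv> card {(i, j). i |\<in>| F \<and> j |\<in>| G \<and> j < i}"

lemma inv_count_swap:
  assumes "F |\<inter>| G = {||}"
  shows "inv_count F G + inv_count G F = fcard F * fcard G"
proof -
  let ?A = "{(i, j). i |\<in>| F \<and> j |\<in>| G \<and> j < i}"
  let ?B = "{(i, j). i |\<in>| F \<and> j |\<in>| G \<and> i < j}"
  have "inv_count G F = card ?B"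
    by (rule bij_betw_same_card[of prod.swap]) (auto simp: bij_betw_def inj_on_def image_iff)
  moreover have "?A \<union> ?B = fset F \<times> fset G" "?A \<inter> ?B = {}"
    using assms by (auto simp: not_less le_less)
  moreover have "card (?A \<union> ?B) = card ?A + card ?B"
    using calculation by (intro card_Un_disjoint) auto
  ultimately show ?thesis by (simp add: card_cartesian_product fcard.rep_eq)
qed

lemma inv_count_remove_left:
  assumes "i |\<in>| F"
  shows "inv_count F G = inv_count (F |-| {|i|}) G + card {j. j |\<in>| G \<and> j < i}"
proof -
  let ?B = "Pair i ` {j. j |\<in>| G \<and> j < i}"
  have "{(i, j). i |\<in>| F \<and> j |\<in>| G \<and> j < i} =
      {(a, j). a |\<in>| F |-| {|i|} \<and> j |\<in>| G \<and> j < a} \<union> ?B"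
    using assms by auto
  moreover have "card ?B = card {j. j |\<in>| G \<and> j < i}" by (rule card_image) (simp add: inj_on_def)
  moreover have "card ({(a, j). a |\<in>| F |-| {|i|} \<and> j |\<in>| G \<and> j < a} \<union> ?B) = card {(a, j). a |\<in>| F |-| {|i|} \<and> j |\<in>| G \<and> j < a} + card ?B"
    by (rule card_Un_disjoint) (rule finite_pairs, auto)
  ultimately show ?thesis by simp
qed

lemma inv_count_remove_right:
  assumes "i |\<in>| G"
  shows "inv_count F G = inv_count F (G |-| {|i|}) + card {j. j |\<in>| F \<and> i < j}"
proof -
  let ?B = "(\<lambda>j. (j, i)) ` {j. j |\<in>| F \<and> i < j}"
  have "{(i, j). i |\<in>| F \<and> j |\<in>| G \<and> j < i} =
      {(a, j). a |\<in>| F \<and> j |\<in>| G |-| {|i|} \<and> j < a} \<union> ?B"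
    using assms by auto
  moreover have "card ?B = card {j. j |\<in>| F \<and> i < j}" by (rule card_image) (simp add: inj_on_def)
  moreover have "card ({(a, j). a |\<in>| F \<and> j |\<in>| G |-| {|i|} \<and> j < a} \<union> ?B) = card {(a, j). a |\<in>| F \<and> j |\<in>| G |-| {|i|} \<and> j < a} + card ?B"
    by (rule card_Un_disjoint) auto
  ultimately show ?thesis by simp
qed

lemma fcard_split:
  fixes F :: "nat fset"
  shows "fcard F = card {j. j |\<in>| F \<and> j < i} + card {j. j |\<in>| F \<and> i < j} + (if i |\<in>| F then 1 else 0)"
proof -
  let ?L = "{j. j |\<in>| F \<and> j < i}" and ?R = "{j. j |\<in>| F \<and> i < j}"
  have "fset F = (?L \<union> ?R) \<union> {j. j |\<in>| F \<and> j = i}"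
    by (auto simp: not_less le_less)
  then have "card (fset F) = card ((?L \<union> ?R) \<union> {j. j |\<in>| F \<and> j = i})" by (rule arg_cong)
  also have "\<dots> = card (?L \<union> ?R) + card {j. j |\<in>| F \<and> j = i}"
    by (rule card_Un_disjoint) auto
  also have "card ({j. j |\<in>| F \<and> j < i} \<union> {j. j |\<in>| F \<and> i < j}) =
      card {j. j |\<in>| F \<and> j < i} + card {j. j |\<in>| F \<and> i < j}"
    by (rule card_Un_disjoint) auto
  also have "{j. j |\<in>| F \<and> j = i} = (if i |\<in>| F then {i} else {})" by auto
  finally show ?thesis by (simp add: fcard.rep_eq)
qed

lemma monom_commute:
  "monom m * monom n = (- 1) ^ (fcard (snd m) * fcard (snd n)) \<cdot> (monom n * monom m :: 'k::comm_ring_1 sdpoly)"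
proof (cases "snd m |\<inter>| snd n = {||}")
  case True
  have "even (inv_count (snd m) (snd n) + inv_count (snd n) (snd m) + fcard (snd m) * fcard (snd n))"
    by (simp add: inv_count_swap[OF True])
  then have "(- 1 :: 'k) ^ inv_count (snd m) (snd n) =
      (- 1) ^ (fcard (snd m) * fcard (snd n) + inv_count (snd n) (snd m))"
    by (auto simp: minus_one_power_iff)
  then show ?thesis using True
    by (simp add: mono_times_mono mono_sign_def mono_join_def inf_commute[of "snd n"]
        sup_commute[of "snd n"] add.commute power_add)
next
  case False
  then show ?thesis by (simp add: mono_times_mono mono_sign_def inf_commute)
qed

lemma part0_commute: "part 0 v * f = f * part 0 v"
proof (rule bilinear_sd_eqI[of "\<lambda>v f. part 0 v * f" "\<lambda>v f. f * part 0 v"])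
  show "part 0 (monom m) * monom n = monom n * part 0 (monom m)" for m n
    using monom_commute[of m n] by (auto simp: part_monom)
qed (simp_all add: linear_sd_def lin)

lemma part1_commute: "part 1 v * f = grad f * part 1 v"
proof (rule bilinear_sd_eqI[of "\<lambda>v f. part 1 v * f" "\<lambda>v f. grad f * part 1 v"])
  show "part 1 (monom m) * monom n = grad (monom n) * part 1 (monom m)" for m n
    using monom_commute[of m n] by (auto simp: part_monom grad_monom times_linear minus_one_power_iff)
qed (simp_all add: linear_sd_def lin)

abbreviation gradn :: "nat \<Rightarrow> 'k::comm_ring_1 sdpoly \<Rightarrow> 'k sdpoly" where
  "gradn p f \<equiv> (if even p then f else grad f)"

lemma part_mod: "part p = part (p mod 2)"
proof -
  have "even (p + c) \<longleftrightarrow> even (p mod 2 + c)" for c by auto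
  then show ?thesis by (simp add: part_def)
qed

lemma homogeneous_commute:
  assumes "part p v = v"
  shows "v * f = gradn p f * v"
proof (cases "even p")
  case True
  then have "part 0 v = v" using assms by (metis part_mod even_iff_mod_2_eq_zero)
  then show ?thesis using part0_commute[of v f] True by simp
next
  case False
  then have "part 1 v = v" using assms by (metis part_mod odd_iff_mod_2_eq_one)
  then show ?thesis using part1_commute[of v f] False by simp
qed

lemma linear_gradn: "linear_sd (gradn p)"
  by (cases "even p") (simp_all add: linear_grad linear_id)

lemma pd_monom_odd: "odd k \<Longrightarrow>
    pd k (monom (B, F)) = of_nat (count B (k div 2)) \<cdot> monom (B - {#k div 2#}, F)"
  by (simp add: pd_def Let_def)

lemma pd_monom_even: "even k \<Longrightarrow> pd k (monom (B, F)) =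
    (if k div 2 |\<in>| F then (- 1) ^ card {j. j |\<in>| F \<and> j < k div 2} \<cdot> monom (B, F |-| {|k div 2|}) else 0)"
  by (simp add: pd_def Let_def)

lemma scal_two: "(2 * x) \<cdot> f = x \<cdot> f + x \<cdot> f" for x :: "'k::comm_ring_1"
  by (metis mult_2 scal_simps(4))

lemma pd_mult_monom:
  "pd k (monom m * monom n) = pd k (monom m) * monom n + gradn (Suc k) (monom m) * (pd k (monom n) :: 'a::comm_ring_1 sdpoly)"
proof -
  obtain B F C G where mn: "m = (B, F)" "n = (C, G)" by (metis surj_pair)
  let ?i = "k div 2"
  show ?thesis
  proof (cases "odd k")
    case True
    note S = mn mono_times_mono mono_join_def mono_sign_def pd_monom_odd[OF True] linear_sdD[OF linear_pd] times_linear
    consider "?i \<notin># B" "?i \<notin># C" | B' where "B = add_mset ?i B'" "?i \<notin># C"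
      | C' where "?i \<notin># B" "C = add_mset ?i C'" | B' C' where "B = add_mset ?i B'" "C = add_mset ?i C'"
      by (metis insert_DiffM)
    then show ?thesis
      by cases (simp_all add: S True not_in_iff algebra_simps scal_two)
  next
    case ev: False
    let ?s = "\<lambda>H. card {j. j |\<in>| H \<and> j < ?i}"
    have s_union: "?s (F |\<union>| G) = ?s F + ?s G" if "F |\<inter>| G = {||}"
    proof -
      have "{j. j |\<in>| F |\<union>| G \<and> j < ?i} = {j. j |\<in>| F \<and> j < ?i} \<union> {j. j |\<in>| G \<and> j < ?i}" by auto
      moreover have "card ({j. j |\<in>| F \<and> j < ?i} \<union> {j. j |\<in>| G \<and> j < ?i}) = ?s F + ?s G"
        using that by (intro card_Un_disjoint) auto
      ultimately show ?thesis by simp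
    qed
    note S = mn mono_times_mono mono_join_def mono_sign_def pd_monom_even[OF \<open>\<not> odd k\<close>[unfolded not_not]] grad_monom
      linear_sdD[OF linear_pd] times_linear
    let ?e = "\<lambda>n. (- 1 :: 'a) ^ n"
    consider "?i |\<notin>| F" "?i |\<notin>| G" | "?i |\<in>| F" "?i |\<notin>| G" | "?i |\<notin>| F" "?i |\<in>| G"
      | "?i |\<in>| F" "?i |\<in>| G" by blast
    then show ?thesis
    proof cases
      case 1
      with ev show ?thesis by (simp add: S)
    next
      case 2
      have FG: "(F |-| {|?i|}) |\<inter>| G = F |\<inter>| G" "(F |-| {|?i|}) |\<union>| G = (F |\<union>| G) |-| {|?i|}"
        using 2 by auto
      show ?thesis
      proof (cases "F |\<inter>| G = {||}")
        case True
        have sg: "?e (inv_count F G) * ?e (?s (F |\<union>| G)) = ?e (?s F) * ?e (inv_count (F |-| {|?i|}) G)"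
          unfolding s_union[OF True] inv_count_remove_left[of ?i F G, OF 2(1)] by (simp add: minus_one_power_iff)
        have "pd k (monom m * monom n) = (?e (inv_count F G) * ?e (?s (F |\<union>| G))) \<cdot> monom (B + C, (F |\<union>| G) |-| {|?i|})"
          using True 2 ev by (simp add: S)
        moreover have "pd k (monom m) * monom n = (?e (?s F) * ?e (inv_count (F |-| {|?i|}) G)) \<cdot> monom (B + C, (F |\<union>| G) |-| {|?i|})"
          using True 2 ev FG by (simp add: S)
        moreover have "pd k (monom n) = (0 :: 'a sdpoly)" using 2 by (simp add: S)
        ultimately show ?thesis unfolding sg by simp
      next
        case False
        with 2 ev FG show ?thesis by (simp add: S)
      qed
    next
      case 3
      have FG: "F |\<inter>| (G |-| {|?i|}) = F |\<inter>| G" "F |\<union>| (G |-| {|?i|}) = (F |\<union>| G) |-| {|?i|}"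
        using 3 by auto
      show ?thesis
      proof (cases "F |\<inter>| G = {||}")
        case True
        have sg: "?e (inv_count F G) * ?e (?s (F |\<union>| G)) = ?e (fcard F) * (?e (?s G) * ?e (inv_count F (G |-| {|?i|})))"
          unfolding s_union[OF True] inv_count_remove_right[of ?i G F, OF 3(2)] fcard_split[of F ?i]
          using 3 by (simp add: minus_one_power_iff)
        have "pd k (monom m * monom n) = (?e (inv_count F G) * ?e (?s (F |\<union>| G))) \<cdot> monom (B + C, (F |\<union>| G) |-| {|?i|})"
          using True 3 ev by (simp add: S)
        moreover have "grad (monom m) * pd k (monom n) = (?e (fcard F) * (?e (?s G) * ?e (inv_count F (G |-| {|?i|})))) \<cdot> monom (B + C, (F |\<union>| G) |-| {|?i|})"
          using True 3 ev FG by (simp add: S mult.commute mult.left_commute)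
        moreover have "pd k (monom m) = (0 :: 'a sdpoly)" using 3 by (simp add: S)
        ultimately show ?thesis unfolding sg using ev by simp
      next
        case False
        with 3 ev FG show ?thesis by (simp add: S)
      qed
    next
      case 4
      have "F |\<inter>| G \<noteq> {||}" using 4 by auto
      then have L: "pd k (monom m * monom n) = (0 :: 'a sdpoly)" by (simp add: S)
      show ?thesis
      proof (cases "F |\<inter>| G = {|?i|}")
        case True
        have FG: "(F |-| {|?i|}) |\<inter>| G = {||}" "F |\<inter>| (G |-| {|?i|}) = {||}"
          "(F |-| {|?i|}) |\<union>| G = F |\<union>| G" "F |\<union>| (G |-| {|?i|}) = F |\<union>| G"
          using True 4 by auto
        have "{j. j |\<in>| F |-| {|?i|} \<and> ?i < j} = {j. j |\<in>| F \<and> ?i < j}" by auto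
        then have I1: "inv_count (F |-| {|?i|}) G = inv_count (F |-| {|?i|}) (G |-| {|?i|}) + card {j. j |\<in>| F \<and> ?i < j}"
          using inv_count_remove_right[of ?i G "F |-| {|?i|}", OF 4(2)] by simp
        have "{j. j |\<in>| G |-| {|?i|} \<and> j < ?i} = {j. j |\<in>| G \<and> j < ?i}" by auto
        then have I2: "inv_count F (G |-| {|?i|}) = inv_count (F |-| {|?i|}) (G |-| {|?i|}) + ?s G"
          using inv_count_remove_left[of ?i F "G |-| {|?i|}", OF 4(1)] by simp
        have sg: "?e (?s F) * ?e (inv_count (F |-| {|?i|}) G) = - (?e (fcard F) * (?e (?s G) * ?e (inv_count F (G |-| {|?i|}))))"
          unfolding I1 I2 fcard_split[of F ?i] using 4 by (simp add: minus_one_power_iff)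
        have "pd k (monom m) * monom n = (?e (?s F) * ?e (inv_count (F |-| {|?i|}) G)) \<cdot> monom (B + C, F |\<union>| G)"
          using 4 ev FG by (simp add: S)
        moreover have "grad (monom m) * pd k (monom n) = (?e (fcard F) * (?e (?s G) * ?e (inv_count F (G |-| {|?i|})))) \<cdot> monom (B + C, F |\<union>| G)"
          using 4 ev FG by (simp add: S mult.commute mult.left_commute)
        ultimately show ?thesis unfolding L sg using ev by simp
      next
        case False
        have "(F |-| {|?i|}) |\<inter>| G \<noteq> {||}" "F |\<inter>| (G |-| {|?i|}) \<noteq> {||}"
          using False 4 by auto
        with 4 ev show ?thesis unfolding L by (simp add: S)
      qed
    qed
  qed
qed

lemma pd_mult: "pd k (f * g) = pd k f * g + gradn (Suc k) f * pd k g"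
proof -
  have L: "linear_sd (\<lambda>f. pd k (f * g))" "linear_sd (\<lambda>g. pd k (f * g))"
    "linear_sd (\<lambda>f. pd k f * g + gradn (Suc k) f * pd k g)"
    "linear_sd (\<lambda>g. pd k f * g + gradn (Suc k) f * pd k g)" for f g :: "'a sdpoly"
    by (simp_all add: linear_sd_def lin add_ac)
  show ?thesis
    by (rule bilinear_sd_eqI[where h = "\<lambda>f g. pd k (f * g)" and h' = "\<lambda>f g. pd k f * g + gradn (Suc k) f * pd k g"])
       (rule L pd_mult_monom)+
qed

lemma finite_pd [simp]: "finite {k. pd k f \<noteq> 0}"
proof (rule finite_subset)
  let ?V = "\<lambda>(B, F). (\<lambda>i. 2 * i + 1) ` set_mset B \<union> (\<lambda>i. 2 * i) ` fset F"
  show "{k. pd k f \<noteq> 0} \<subseteq> (\<Union>m\<in>support f. ?V m)"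
  proof
    fix k assume "k \<in> {k. pd k f \<noteq> 0}"
    then have "(\<Sum>m\<in>support f. mcoeff f m \<cdot> pd k (monom m)) \<noteq> 0"
      by (subst (asm) sdpoly_expand[of f]) (simp add: linear_sdD[OF linear_pd])
    then obtain m where m: "m \<in> support f" "pd k (monom m) \<noteq> (0 :: 'a sdpoly)"
      by (metis (no_types, lifting) scal_simps(9) sum.neutral)
    obtain B F where "m = (B, F)" by (cases m)
    have "k \<in> ?V (B, F)"
    proof (cases "odd k")
      case True
      have "count B (k div 2) \<noteq> 0"
        using m \<open>m = (B, F)\<close> pd_monom_odd[OF True, of B F] by (metis of_nat_0 scal_simps(8))
      then have "k div 2 \<in># B" by (simp add: not_in_iff)
      moreover have "k = 2 * (k div 2) + 1" using True by simp
      ultimately show ?thesis by blast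
    next
      case False
      then have "k div 2 |\<in>| F"
        using m \<open>m = (B, F)\<close> pd_monom_even[of k B F] by (metis (no_types))
      moreover have "k = 2 * (k div 2)" using False by simp
      ultimately show ?thesis by blast
    qed
    with \<open>m = (B, F)\<close> have "k \<in> ?V m" by simp
    with m show "k \<in> (\<Union>m\<in>support f. ?V m)" by blast
  qed
qed (auto split: prod.splits)

lemma evolutionary_superset:
  assumes "finite S" "{k. pd k f \<noteq> 0} \<subseteq> S"
  shows "evolutionary v f = (\<Sum>k\<in>S. v k * pd k f)"
  unfolding evolutionary_def using assms by (intro sum.mono_neutral_left) auto

lemma linear_evolutionary: "linear_sd (evolutionary v)"
proof -
  have "evolutionary v (f + g) = evolutionary v f + evolutionary v g" for f g
  proof -
    let ?S = "{k. pd k f \<noteq> 0} \<union> {k. pd k g \<noteq> 0} \<union> {k. pd k (f + g) \<noteq> 0}"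
    have "evolutionary v x = (\<Sum>k\<in>?S. v k * pd k x)" if "x \<in> {f, g, f + g}" for x
      using that by (intro evolutionary_superset) auto
    then show ?thesis by (simp add: sum.distrib lin)
  qed
  moreover have "evolutionary v (c \<cdot> f) = c \<cdot> evolutionary v f" for c f
  proof -
    have "evolutionary v (c \<cdot> f) = (\<Sum>k | pd k f \<noteq> 0. v k * pd k (c \<cdot> f))"
      by (intro evolutionary_superset) (auto simp: lin)
    then show ?thesis by (simp add: evolutionary_def lin scal_sum)
  qed
  ultimately show ?thesis by (simp add: linear_sd_def)
qed

lemma evolutionary_mult:
  assumes "\<And>k. part (Suc k + q) (v k) = v k"
  shows "evolutionary v (f * g) = evolutionary v f * g + gradn q f * evolutionary v g"
proof -
  let ?S = "{k. pd k f \<noteq> 0} \<union> {k. pd k g \<noteq> 0} \<union> {k. pd k (f * g) \<noteq> 0}"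
  have e: "evolutionary v x = (\<Sum>k\<in>?S. v k * pd k x)" if "x \<in> {f, g, f * g}" for x
    using that by (intro evolutionary_superset) auto
  have "v k * pd k (f * g) = v k * pd k f * g + gradn q f * (v k * pd k g)" for k
  proof -
    have "v k * gradn (Suc k) f = gradn (Suc k + q) (gradn (Suc k) f) * v k"
      by (rule homogeneous_commute[OF assms])
    also have "gradn (Suc k + q) (gradn (Suc k) f) = gradn q f" by auto
    finally have "v k * gradn (Suc k) f * pd k g = gradn q f * v k * pd k g" by (rule arg_cong)
    then show ?thesis unfolding pd_mult by (simp only: distrib_left mult.assoc)
  qed
  then show ?thesis by (simp add: e sum.distrib sum_distrib_left sum_distrib_right)
qed

lemma pd_gen: "pd j (gen k) = (if j = k then 1 else 0)"
proof -
  have "k div 2 = j div 2 \<longleftrightarrow> j = k" if "odd j \<longleftrightarrow> odd k"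
    using that by (metis odd_two_times_div_two_succ even_two_times_div_two)
  then show ?thesis
    by (cases "odd j") (auto simp: gen_def pd_monom_odd pd_monom_even one_sdpoly_def Collect_conv_if)
qed

lemma evolutionary_gen [simp]: "evolutionary v (gen k) = v k"
  by (subst evolutionary_superset[of "{k}"]) (auto simp: pd_gen)

lemma part_gen: "part (Suc k) (gen k) = gen k"
  by (auto simp: gen_def part_monom fcard.rep_eq)

lemma linear_D: "linear_sd D"
  by (simp add: D_def linear_evolutionary)

lemma D_gen [simp]: "D (gen k) = gen (Suc k)"
  by (simp add: D_def)

lemma D_mult: "D (f * g) = D f * g + grad f * D g"
  using evolutionary_mult[of 1 "\<lambda>k. gen (Suc k)" f g] by (simp add: D_def part_gen)

lemma part_cong: "even (p + q) \<Longrightarrow> part p = part q"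
  unfolding part_def by (intro arg_cong[of _ _ linext] ext) auto

lemma part_mult:
  assumes "part a v = v"
  shows "part (a + b) (v * g) = v * part b g"
proof -
  have "part (a + b) (part a v * g) = part a v * part b g"
  proof (rule bilinear_sd_eqI[where h = "\<lambda>v g. part (a + b) (part a v * g)" and h' = "\<lambda>v g. part a v * part b g"])
    fix m n
    show "part (a + b) (part a (monom m) * monom n) = part a (monom m) * part b (monom n :: 'a sdpoly)"
    proof (cases "snd m |\<inter>| snd n = {||}")
      case True
      then have "fcard (snd m |\<union>| snd n) = fcard (snd m) + fcard (snd n)"
        using fcard_funion_finter[of "snd m" "snd n"] by simp
      then show ?thesis
        by (auto simp: part_monom mono_times_mono linear_sdD[OF linear_part] mono_join_def times_linear)
    next
      case False
      then show ?thesis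
        by (auto simp: part_monom mono_times_mono linear_sdD[OF linear_part] mono_sign_def times_linear)
    qed
  qed (simp_all add: linear_sd_def lin)
  then show ?thesis by (simp add: assms)
qed

lemma part_pd: "part (p + Suc k) (pd k f) = pd k (part p f)"
proof (rule linear_sd_eqI[of "\<lambda>f. part (p + Suc k) (pd k f)" "\<lambda>f. pd k (part p f)"])
  fix m :: smono
  obtain B F where m: "m = (B, F)" by (cases m)
  note S = m part_monom linear_sdD[OF linear_part] linear_sdD[OF linear_pd]
  show "part (p + Suc k) (pd k (monom m)) = (pd k (part p (monom m)) :: 'a sdpoly)"
  proof (cases "odd k")
    case True
    then show ?thesis by (simp add: S pd_monom_odd)
  next
    case False
    then have ev: "even k" by simp
    show ?thesis
    proof (cases "k div 2 |\<in>| F")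
      case True
      define n where "n = fcard (F |-| {|k div 2|})"
      then have "fcard F = Suc n" using True by (metis fcard_Suc_fminus1)
      then show ?thesis using ev True by (simp add: S pd_monom_even)
    next
      case False
      then show ?thesis using ev by (simp add: S pd_monom_even)
    qed
  qed
qed (simp_all add: linear_sd_def lin)

lemma part_evolutionary:
  assumes "\<And>k. part (Suc k + q) (v k) = v k"
  shows "part (p + q) (evolutionary v f) = evolutionary v (part p f)"
proof -
  let ?S = "{k. pd k f \<noteq> 0} \<union> {k. pd k (part p f) \<noteq> 0}"
  have e: "evolutionary v x = (\<Sum>k\<in>?S. v k * pd k x)" if "x \<in> {f, part p f}" for x
    using that by (intro evolutionary_superset) auto
  have "part (p + q) (v k * pd k f) = v k * pd k (part p f)" for k
  proof -
    have "part (p + q) (v k * pd k f) = part (Suc k + q + (p + Suc k)) (v k * pd k f)"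
      by (rule arg_cong[where f = "\<lambda>h. h (v k * pd k f)"], rule part_cong) presburger
    also have "\<dots> = v k * part (p + Suc k) (pd k f)" by (rule part_mult[OF assms])
    finally show ?thesis by (simp only: part_pd)
  qed
  then show ?thesis by (simp add: e linear_sdD[OF linear_part])
qed

lemma part_D: "part (Suc p) (D f) = D (part p f)"
  using part_evolutionary[of 1 "\<lambda>k. gen (Suc k)" p f] by (simp add: D_def part_gen)

lemma part_funpow_D: "part 1 f = f \<Longrightarrow> part (Suc k) ((D ^^ k) f) = (D ^^ k) f"
  by (induction k) (simp_all add: part_D)

lemma grad_D: "grad (D f) = - D (grad f)"
proof -
  have "part 0 (D f) = part 2 (D f)"
    by (rule arg_cong[where f = "\<lambda>h. h (D f)"], rule part_cong) simp
  also have "\<dots> = D (part 1 f)" using part_D[of 1 f] by (simp add: numeral_2_eq_2)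
  finally show ?thesis using part_D[of 0 f] by (simp add: grad_def linear_sdD[OF linear_D])
qed

lemma sdpoly_gen_induct:
  assumes "linear_sd h" "h 1 = 0" "\<And>k f. h f = 0 \<Longrightarrow> h (gen k * f) = 0"
  shows "h f = 0"
proof (rule linear_sd_eqI[of h "\<lambda>_. 0"])
  fix m :: smono
  obtain B F where m: "m = (B, F)" by (cases m)
  have "h (monom ({#}, F)) = 0"
  proof (induction F)
    case (insert i F)
    have "gen (2 * i) * monom ({#}, F) = mono_sign ({#}, {|i|}) ({#}, F) \<cdot> (monom ({#}, finsert i F) :: 'a sdpoly)"
      by (simp add: gen_def mono_times_mono mono_join_def)
    moreover have "mono_sign ({#}, {|i|}) ({#}, F) * mono_sign ({#}, {|i|}) ({#}, F) = (1 :: 'a)"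
      using insert.hyps by (simp add: mono_sign_def power_mult_distrib[symmetric])
    ultimately have "monom ({#}, finsert i F) = mono_sign ({#}, {|i|}) ({#}, F) \<cdot> (gen (2 * i) * monom ({#}, F) :: 'a sdpoly)"
      by simp
    then show ?case using insert.IH assms(3) by (simp add: linear_sdD[OF assms(1)])
  qed (use assms(2) in \<open>simp add: one_sdpoly_def\<close>)
  then have "h (monom (B, F)) = 0"
  proof (induction B)
    case (add b B)
    have "monom (add_mset b B, F) = (gen (2 * b + 1) * monom (B, F) :: 'a sdpoly)"
      by (simp add: gen_def mono_times_mono mono_join_def mono_sign_def)
    then show ?case using add assms(3) by simp
  qed
  then show "h (monom m) = 0" by (simp add: m)
qed (use assms(1) in \<open>simp_all add: linear_sd_def\<close>)

definition even_derivation :: "('k::comm_ring_1 sdpoly \<Rightarrow> 'k sdpoly) \<Rightarrow> bool" where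
  "even_derivation d \<longleftrightarrow> linear_sd d \<and> (\<forall>f g. d (f * g) = d f * g + f * d g)
     \<and> (\<forall>p f. d (part p f) = part p (d f))"

text \<open>Every odd \<open>P\<close> is the right-hand side of an evolution equation \<open>\<phi>\<^sub>t = P\<close> of this kind.\<close>

lemma ex_flow:
  fixes P :: "'k::comm_ring_1 sdpoly"
  assumes P: "part 1 P = P"
  shows "\<exists>d. even_derivation d \<and> (\<forall>f. d (D f) = D (d f)) \<and> d \<phi> = P"
proof (intro exI conjI allI)
  let ?d = "evolutionary (\<lambda>k. (D ^^ k) P)"
  note h = part_funpow_D[OF P]
  have mult: "?d (f * g) = ?d f * g + f * ?d g" for f g
    using evolutionary_mult[of 0 "\<lambda>k. (D ^^ k) P" f g] h by simp
  have part: "part p (?d f) = ?d (part p f)" for p f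
    using part_evolutionary[of 0 "\<lambda>k. (D ^^ k) P" p f] h by simp
  note lind = linear_sdD[OF linear_evolutionary] linear_sdD[OF linear_D]
  show "even_derivation ?d"
    using mult part linear_evolutionary by (simp add: even_derivation_def)
  have gr: "grad (?d f) = ?d (grad f)" for f by (simp add: grad_def part lind)
  let ?h = "\<lambda>f. ?d (D f) - D (?d f)"
  show "?d (D f) = D (?d f)" for f
  proof -
    have "?h f = 0"
    proof (rule sdpoly_gen_induct[of ?h])
      show "linear_sd ?h" by (simp add: linear_sd_def lind)
      have "?d 1 = 0" using mult[of 1 1] by simp
      moreover have "grad (1 :: 'k sdpoly) = 1" by (simp add: one_sdpoly_def grad_monom fcard.rep_eq)
      then have "D (1 :: 'k sdpoly) = 0" using D_mult[of "1 :: 'k sdpoly" 1] by simp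
      ultimately show "?h 1 = 0" by (simp add: lind)
      show "?h (gen k * f) = 0" if "?h f = 0" for k f
        using that by (simp add: D_mult mult lind algebra_simps flip: gr)
    qed
    then show ?thesis by simp
  qed
  show "?d \<phi> = P" by simp
qed

abbreviation dx :: "'k::comm_ring_1 sdpoly \<Rightarrow> 'k sdpoly" where
  "dx f \<equiv> D (D f)"

text \<open>The formal integral is left abstract: any linear functional vanishing on the image of \<open>D\<close>.\<close>

definition formal_integral :: "('k::comm_ring_1 sdpoly \<Rightarrow> 'k) \<Rightarrow> bool" where
  "formal_integral J \<longleftrightarrow> (\<forall>f g. J (f + g) = J f + J g) \<and> (\<forall>c f. J (c \<cdot> f) = c * J f)
     \<and> (\<forall>f. J (D f) = 0)"


section \<open>Super pseudodifferential operators\<close>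

typedef (overloaded) ('k::field_char_0) psdo =
    "{a :: int \<Rightarrow> 'k sdpoly. \<exists>N. \<forall>k>N. a k = 0}"
  morphisms pcoeff Psdo
  by (intro exI[of _ "\<lambda>_. 0"]) auto

lifting_forget sdpoly.lifting
setup_lifting type_definition_psdo

lemma psdo_bound: "\<exists>N. \<forall>k>N. pcoeff P k = 0"
  using pcoeff[of P] by simp

text \<open>
  Super binomial coefficients: \<open>\<D>\<^sup>n a = \<Sum>\<^sub>r [n, r] (-1)\<^sup>|\<^sup>a\<^sup>|\<^sup>(\<^sup>n\<^sup>-\<^sup>r\<^sup>) (\<D>\<^sup>r a) \<D>\<^sup>n\<^sup>-\<^sup>r\<close> for every integer
  \<open>n\<close>.  Since \<open>r (n - r)\<close> is even whenever \<open>[n, r] \<noteq> 0\<close>, the sign may be read off \<open>\<D>\<^sup>r a\<close> instead of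
  \<open>a\<close>.
\<close>

definition sbinom :: "int \<Rightarrow> nat \<Rightarrow> 'k::field_char_0" where
  "sbinom n r = (if even n \<and> odd r then 0 else of_int (n div 2) gchoose (r div 2))"

lift_definition Dop :: "int \<Rightarrow> 'k::field_char_0 psdo" is "\<lambda>n k. if k = n then 1 else 0"
proof -
  show "\<exists>N. \<forall>k>N. (if k = n then 1 else 0) = (0 :: 'k sdpoly)" for n :: int
    by (rule exI[of _ n]) simp
qed

lift_definition fop :: "'k::field_char_0 sdpoly \<Rightarrow> 'k psdo" is "\<lambda>f k. if k = 0 then f else 0"
  by (rule exI[of _ 0]) simp

instantiation psdo :: (field_char_0) ab_group_add
begin

lift_definition zero_psdo :: "'a psdo" is "\<lambda>_. 0" by simp

lift_definition plus_psdo :: "'a psdo \<Rightarrow> 'a psdo \<Rightarrow> 'a psdo" is "\<lambda>P Q k. P k + Q k"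
proof -
  fix P Q :: "int \<Rightarrow> 'a sdpoly"
  assume "\<exists>N. \<forall>k>N. P k = 0" "\<exists>N. \<forall>k>N. Q k = 0"
  then obtain M N where "\<forall>k>M. P k = 0" "\<forall>k>N. Q k = 0" by blast
  then show "\<exists>N. \<forall>k>N. P k + Q k = 0" by (intro exI[of _ "max M N"]) simp
qed

lift_definition uminus_psdo :: "'a psdo \<Rightarrow> 'a psdo" is "\<lambda>P k. - P k" by simp

definition minus_psdo :: "'a psdo \<Rightarrow> 'a psdo \<Rightarrow> 'a psdo" where "minus_psdo P Q = P + (- Q)"

instance
proof
  fix P Q R :: "'a psdo"
  show "P + Q + R = P + (Q + R)" by transfer (simp add: add.assoc)
  show "P + Q = Q + P" by transfer (simp add: add.commute)
  show "0 + P = P" by transfer simp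
  show "- P + P = 0" by transfer simp
  show "P - Q = P + - Q" by (rule minus_psdo_def)
qed

end

lemma finite_times_psdo:
  "finite {(i, r). pcoeff P i \<noteq> 0 \<and> pcoeff Q (n - i + int r) \<noteq> 0}"
proof -
  obtain M where M: "\<forall>k>M. pcoeff P k = 0" using psdo_bound[of P] ..
  obtain N where N: "\<forall>k>N. pcoeff Q k = 0" using psdo_bound[of Q] ..
  have "i \<in> {n - N..M} \<and> r \<in> {..nat (N - n + M)}" if "pcoeff P i \<noteq> 0" "pcoeff Q (n - i + int r) \<noteq> 0" for i r
  proof -
    have "\<not> M < i" using M that(1) by blast
    moreover have "\<not> N < n - i + int r" using N that(2) by blast
    ultimately show ?thesis by auto
  qed
  then have "{(i, r). pcoeff P i \<noteq> 0 \<and> pcoeff Q (n - i + int r) \<noteq> 0} \<subseteq> {n - N..M} \<times> {..nat (N - n + M)}"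
    by blast
  then show ?thesis by (rule finite_subset) simp
qed

instantiation psdo :: (field_char_0) "{one, times}"
begin

definition one_psdo :: "'a psdo" where
  "1 = Dop 0"

lift_definition times_psdo :: "'a psdo \<Rightarrow> 'a psdo \<Rightarrow> 'a psdo" is
  "\<lambda>P Q n. \<Sum>(i, r) | P i \<noteq> 0 \<and> Q (n - i + int r) \<noteq> 0.
     sbinom i r \<cdot> (P i * (if even (i - int r) then id else grad) ((D ^^ r) (Q (n - i + int r))))"
proof -
  fix P Q :: "int \<Rightarrow> 'a sdpoly"
  assume "\<exists>N. \<forall>k>N. P k = 0" "\<exists>N. \<forall>k>N. Q k = 0"
  then obtain M N where MN: "\<forall>k>M. P k = 0" "\<forall>k>N. Q k = 0" by blast
  show "\<exists>N. \<forall>n>N. (\<Sum>(i, r) | P i \<noteq> 0 \<and> Q (n - i + int r) \<noteq> 0.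
     sbinom i r \<cdot> (P i * (if even (i - int r) then id else grad) ((D ^^ r) (Q (n - i + int r))))) = 0"
  proof (intro exI[of _ "M + N"] allI impI)
    fix n assume "M + N < n"
    have "P i = 0 \<or> Q (n - i + int r) = 0" for i r
    proof (cases "M < i")
      case False
      then have "N < n - i + int r" using \<open>M + N < n\<close> by linarith
      then show ?thesis using MN(2) by blast
    qed (use MN(1) in blast)
    then have e: "{(i, r). P i \<noteq> 0 \<and> Q (n - i + int r) \<noteq> 0} = {}" by auto
    show "(\<Sum>(i, r) | P i \<noteq> 0 \<and> Q (n - i + int r) \<noteq> 0.
     sbinom i r \<cdot> (P i * (if even (i - int r) then id else grad) ((D ^^ r) (Q (n - i + int r))))) = 0"
      by (simp only: e sum.empty)
  qed
qed

instance ..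

end

text \<open>The product is the one generated by \<open>\<D> a = (\<D>a) + (-1)\<^sup>|\<^sup>a\<^sup>| a \<D>\<close>.\<close>

lemma pcoeff_Dop_fop:
  "pcoeff (Dop m * fop f) n =
     (if n \<le> m then sbinom m (nat (m - n)) \<cdot> (if even n then id else grad) ((D ^^ nat (m - n)) f) else 0)"
proof (cases "n \<le> m \<and> f \<noteq> 0")
  case True
  have "{(i, r). (if i = m then 1 else 0 :: 'a sdpoly) \<noteq> 0 \<and> (if n - i + int r = 0 then f else 0) \<noteq> 0}
      = {(m, nat (m - n))}"
    using True by (auto split: if_splits)
  moreover have "even (nat (m - n)) \<longleftrightarrow> (even m \<longleftrightarrow> even n)"
    using True by (simp add: even_nat_iff)
  ultimately show ?thesis
    using True by (simp add: times_psdo.rep_eq Dop.rep_eq fop.rep_eq)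
next
  case False
  have "linear_sd ((D ^^ r) :: 'a sdpoly \<Rightarrow> 'a sdpoly)" for r
    by (induction r) (simp_all add: linear_sd_def linear_sdD[OF linear_D])
  then have "(D ^^ r) 0 = (0 :: 'a sdpoly)" for r by (rule linear_sdD(3))
  moreover have "{(i, r). (if i = m then 1 else 0 :: 'a sdpoly) \<noteq> 0 \<and> (if n - i + int r = 0 then f else 0) \<noteq> 0} = {}"
    using False by auto
  ultimately show ?thesis
    using False by (auto simp: times_psdo.rep_eq Dop.rep_eq fop.rep_eq linear_sdD(3)[OF linear_grad])
qed

lemma pcoeff_fop_Dop: "pcoeff (fop f * Dop m) n = (if n = m then f else 0)"
proof -
  have "{(i, r). (if i = 0 then f else 0) \<noteq> 0 \<and> (if n - i + int r = m then 1 else 0 :: 'a sdpoly) \<noteq> 0}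
      = (if f \<noteq> 0 \<and> n \<le> m then {(0, nat (m - n))} else {})"
    by (auto split: if_splits)
  moreover have "sbinom 0 r = (if r = 0 then 1 else 0 :: 'a)" for r
    by (auto simp: sbinom_def gbinomial_0_left elim: oddE)
  moreover have "(if even n then id else grad) 1 = (1 :: 'a sdpoly)"
    by (simp add: one_sdpoly_def grad_monom fcard.rep_eq)
  ultimately show ?thesis
    by (auto simp: times_psdo.rep_eq Dop.rep_eq fop.rep_eq)
qed

lemma Dop_1_fop: "Dop 1 * fop f = fop (D f) + fop (grad f) * Dop 1"
proof -
  have s: "sbinom 1 r = (if r \<le> 1 then 1 else 0 :: 'a)" for r
  proof -
    have "r div 2 = 0 \<longleftrightarrow> r \<le> 1" by auto
    then show ?thesis by (simp add: sbinom_def gbinomial_0_left)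
  qed
  have "pcoeff (Dop 1 * fop f) n = pcoeff (fop (D f) + fop (grad f) * Dop 1) n" for n
  proof -
    consider "n = 1" | "n = 0" | "n > 1" | "n < 0" by linarith
    moreover have "\<not> nat (1 - n) \<le> Suc 0" if "n < 0" using that by simp
    ultimately show ?thesis
      by cases (simp_all add: pcoeff_Dop_fop pcoeff_fop_Dop plus_psdo.rep_eq fop.rep_eq s)
  qed
  then show ?thesis by (simp add: pcoeff_inject[symmetric] fun_eq_iff)
qed

instance psdo :: (field_char_0) power ..

instance psdo :: (field_char_0) numeral ..

lift_definition plus_part :: "'k::field_char_0 psdo \<Rightarrow> 'k psdo"
  is "\<lambda>P k. if k \<ge> 0 then P k else 0"
  by auto

definition sres :: "'k::field_char_0 psdo \<Rightarrow> 'k sdpoly" where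
  "sres P = pcoeff P (- 1)"

text \<open>Homogeneous component of parity \<open>p\<close>; the symbol \<open>a \<D>\<^sup>k\<close> has parity \<open>|a| + k\<close>.\<close>

lift_definition ppart :: "nat \<Rightarrow> 'k::field_char_0 psdo \<Rightarrow> 'k psdo"
  is "\<lambda>p P k. part (p + nat \<bar>k\<bar>) (P k)"
proof -
  fix p and P :: "int \<Rightarrow> 'k sdpoly"
  assume "\<exists>N. \<forall>k>N. P k = 0"
  then obtain N where "\<forall>k>N. P k = 0" by blast
  then show "\<exists>N. \<forall>k>N. part (p + nat \<bar>k\<bar>) (P k) = 0"
    by (intro exI[of _ N]) (simp add: linear_sdD(3)[OF linear_part])
qed

definition scomm :: "'k::field_char_0 psdo \<Rightarrow> 'k psdo \<Rightarrow> 'k psdo" where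
  "scomm A B = (\<Sum>i<2. \<Sum>j<2. if even (i * j)
     then ppart i A * ppart j B - ppart j B * ppart i A
     else ppart i A * ppart j B + ppart j B * ppart i A)"

text \<open>Coefficientwise application; meaningful when \<open>d 0 = 0\<close>, in particular for derivations.\<close>

definition pmap :: "('k::field_char_0 sdpoly \<Rightarrow> 'k sdpoly) \<Rightarrow> 'k psdo \<Rightarrow> 'k psdo" where
  "pmap d P = Psdo (\<lambda>k. d (pcoeff P k))"

definition lax_sqrt :: "'k::field_char_0 psdo" where
  "lax_sqrt = Dop 3 + fop \<phi>"

definition lax_op :: "'k::field_char_0 psdo" where
  "lax_op = lax_sqrt * lax_sqrt"

text \<open>
  The odd cube root \<open>\<Lambda> = \<D> + O(1)\<close> of \<open>\<D>\<^sup>3 + \<phi>\<close> is a sixth root of \<open>lax_op\<close>, whose powers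
  \<open>L\<^sup>n\<^sup>/\<^sup>6 = \<Lambda>\<^sup>n\<close> are defined through it; \<open>lax_root_pow 10\<close> is \<open>L\<^sup>5\<^sup>/\<^sup>3\<close>.
\<close>

definition lax_root :: "'k::field_char_0 psdo" where
  "lax_root = (THE P. ppart 1 P = P \<and> (\<forall>k>0. pcoeff (P - Dop 1) k = 0) \<and> P ^ 3 = lax_sqrt)"

definition lax_root_pow :: "nat \<Rightarrow> 'k::field_char_0 psdo" where
  "lax_root_pow n = lax_root ^ n"

end

theory Submission
  imports Defs
begin

text \<open>
  Write \<open>S = \<D>\<^sup>3 + \<phi>\<close>, so that \<open>\<Lambda>\<close> is the cube root of \<open>S\<close>.  For operators \<open>\<Lambda> = \<D> + O(1)\<close> the linearised cube
  \<open>X \<mapsto> X \<Lambda>\<^sup>2 + \<Lambda> X \<Lambda> + \<Lambda>\<^sup>2 X\<close> acts on a leading coefficient \<open>a\<close> as \<open>2 a + (-1)\<^sup>|\<^sup>a\<^sup>| a\<close> and is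
  therefore injective.  This yields existence and uniqueness of \<open>\<Lambda>\<close>, and it reduces the Lax equation for
  \<open>\<Lambda>\<close>, hence for all \<open>\<Lambda>\<^sup>n\<close>, to that for \<open>S\<close>.

  There is an explicit even differential operator \<open>B = 9 \<D>\<^sup>1\<^sup>0 + \<dots>\<close> such that \<open>[B, S]\<close> is the function
  \<open>\<phi>\<^sub>t\<close>.  It equals \<open>9 (\<Lambda>\<^sup>1\<^sup>0)\<^sub>+\<close> without any expansion of \<open>\<Lambda>\<close>: the even operator \<open>R = 9 \<Lambda>\<^sup>1\<^sup>0 - B\<close> has a
  commutator of order at most \<open>0\<close> with \<open>S\<close>, which forces its leading coefficient \<open>r\<close>, if of nonnegative order,
  to satisfy \<open>r = 0\<close> or \<open>r\<^sub>x = 0\<close>; but \<open>\<D>\<close> kills only constants and the coefficients of \<open>R\<close> have no constant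
  term.

  Finally \<open>sres\<close> of a supercommutator \<open>[A, Q]\<close> lies in \<open>Im \<D>\<close> when \<open>A\<close> is a function or \<open>A = \<D>\<close>, and the
  operators \<open>A\<close> with this property are closed under products and sums.
\<close>

section \<open>Powers of the super derivative\<close>

text \<open>The coefficient of \<open>\<D>\<^sup>i\<^sup>-\<^sup>r\<close> in \<open>\<D>\<^sup>i f\<close>.\<close>

definition dpow :: "int \<Rightarrow> nat \<Rightarrow> 'k::field_char_0 sdpoly \<Rightarrow> 'k sdpoly" where
  "dpow i r f = sbinom i r \<cdot> (if even (i - int r) then id else grad) ((D ^^ r) f)"

lemma linear_funpow_D: "linear_sd (D ^^ r)"
  by (induction r) (simp_all add: linear_sd_def linear_sdD[OF linear_D])

lemma linear_dpow: "linear_sd (dpow i r)"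
  by (auto simp: linear_sd_def dpow_def linear_sdD[OF linear_funpow_D] linear_sdD[OF linear_grad] mult.commute)

lemmas dpow_lin = linear_sdD[OF linear_dpow]
lemmas D_lin = linear_sdD[OF linear_D]
lemmas grad_lin = linear_sdD[OF linear_grad]

lemma dpow_0: "dpow 0 r f = (if r = 0 then f else 0)"
  by (auto simp: dpow_def sbinom_def gbinomial_0_left elim: oddE)

lemma dpow_0_right: "dpow i 0 f = (if even i then f else grad f)"
  by (simp add: dpow_def sbinom_def)

text \<open>A super Pascal rule. When \<open>i\<close> and \<open>r\<close> are both odd it is the
  ordinary rule for the halved indices; for the other parities the terms agree or cancel.\<close>

lemma sbinom_Suc:
  "sbinom (i + 1) (Suc r) = sbinom i (Suc r) + (if even (i - int r) then 1 else - 1) * (sbinom i r :: 'k::field_char_0)"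
proof -
  consider (ee) a b where "i = 2 * a" "r = 2 * b" | (eo) a b where "i = 2 * a" "r = 2 * b + 1"
    | (oe) a b where "i = 2 * a + 1" "r = 2 * b" | (oo) a b where "i = 2 * a + 1" "r = 2 * b + 1"
    by (metis evenE oddE)
  then show ?thesis
  proof cases
    case eo
    then show ?thesis by (simp add: sbinom_def)
  next
    case oo
    have "(of_int (a + 1) gchoose Suc b :: 'k) = (of_int a gchoose Suc b) + (of_int a gchoose b)"
      using gbinomial_Suc_Suc[of "of_int a :: 'k" b] by (simp add: add.commute)
    moreover have "(2 * a + 1 + 1) div 2 = a + 1" "Suc (2 * b + 1) div 2 = Suc b" by simp_all
    ultimately show ?thesis
      unfolding oo by (simp add: sbinom_def add.commute)
  qed (simp_all add: sbinom_def)
qed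

text \<open>One more \<open>D\<close> applied from the left to the expansion of \<open>D\<close>^i
  f. The signs in \<open>sbinom_Suc\<close> match because \<open>grad\<close> anticommutes with
  \<open>D\<close>.\<close>

lemma dpow_Suc: "dpow (i + 1) (Suc r) f = grad (dpow i (Suc r) f) + D (dpow i r f)"
proof -
  have "D (grad g) = - grad (D g)" for g :: "'a sdpoly"
    by (simp add: grad_D)
  then show ?thesis
    by (simp add: dpow_def sbinom_Suc D_lin grad_lin)
qed

lemma dpow_Suc_0: "dpow (i + 1) 0 f = grad (dpow i 0 f)"
  by (simp add: dpow_0_right)

lemma grad_eq_0_iff [simp]: "grad f = 0 \<longleftrightarrow> f = 0"
  by (metis grad_grad grad_lin(3))

text \<open>
  \<open>F\<close> is the defect of an identity for \<open>\<D>\<^sup>i\<close>; it can be propagated to negative \<open>i\<close> as well because \<open>grad\<close> is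
  invertible.
\<close>

lemma Pascal_vanish:
  fixes F :: "int \<Rightarrow> nat \<Rightarrow> 'k::field_char_0 sdpoly"
  assumes F0: "\<And>t. F 0 t = 0"
    and rec0: "\<And>i. F (i + 1) 0 = grad (F i 0)"
    and rec: "\<And>i t. F (i + 1) (Suc t) = grad (F i (Suc t)) + D (F i t)"
  shows "F i t = 0"
proof -
  have "\<forall>t. F i t = 0"
  proof (induction i rule: int_induct[where k = 0])
    case (step1 i)
    show ?case
    proof
      fix t
      show "F (i + 1) t = 0"
        using step1 by (cases t) (simp_all add: rec0 rec grad_lin D_lin)
    qed
  next
    case (step2 i)
    show ?case
    proof
      fix t
      show "F (i - 1) t = 0"
      proof (induction t)
        case 0
        then show ?case using rec0[of "i - 1"] step2 by simp
      next
        case (Suc t)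
        then show ?case using rec[of "i - 1" t] step2 by (simp add: D_lin)
      qed
    qed
  qed (simp add: F0)
  then show ?thesis by simp
qed

text \<open>Exponent law for \<open>D\<close>^i \<open>D\<close>^j acting on a function, read off
  coefficientwise. Both sides obey the recursion in \<open>i\<close> of \<open>dpow_Suc\<close>, so
  the defect vanishes by \<open>Pascal_vanish\<close>.\<close>

lemma dpow_dpow: "(\<Sum>v\<le>N. dpow i v (dpow j (N - v) c)) = dpow (i + j) N c"
proof -
  define F where "F i N = (\<Sum>v\<le>N. dpow i v (dpow j (N - v) c)) - dpow (i + j) N c" for i N
  have "F i N = 0"
  proof (rule Pascal_vanish)
    show "F 0 t = 0" for t
      by (simp add: F_def dpow_0 if_distrib[of "\<lambda>x. _ x"] sum.delta cong: if_cong)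
    have e: "i + 1 + j = i + j + 1" for i by simp
    show "F (i + 1) 0 = grad (F i 0)" for i
      unfolding F_def e by (simp add: dpow_Suc_0 grad_lin)
    show "F (i + 1) (Suc t) = grad (F i (Suc t)) + D (F i t)" for i t
      unfolding F_def e sum.atMost_Suc_shift[of _ t]
      by (simp add: dpow_Suc_0 dpow_Suc grad_lin D_lin sum.distrib)
  qed
  then show ?thesis by (simp add: F_def)
qed

text \<open>Moving \<open>D\<close>^i first past \<open>b\<close> and then the remaining power past
  \<open>c\<close>. With \<open>dpow_dpow\<close> this is all that associativity of operators
  requires.\<close>

lemma dpow_mult: "dpow i t (b * c) = (\<Sum>r\<le>t. dpow i r b * dpow (i - int r) (t - r) c)"
proof -
  define F where "F i t = (\<Sum>r\<le>t. dpow i r b * dpow (i - int r) (t - r) c) - dpow i t (b * c)" for i t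
  have "F i t = 0"
  proof (rule Pascal_vanish)
    show "F 0 t = 0" for t
    proof -
      have "(\<Sum>r\<le>t. dpow 0 r b * dpow (0 - int r) (t - r) c) = (\<Sum>r\<le>t. if r = 0 then b * dpow 0 t c else 0)"
        by (intro sum.cong) (auto simp: dpow_0)
      then show ?thesis by (simp add: F_def dpow_0)
    qed
    show "F (i + 1) 0 = grad (F i 0)" for i
      by (simp add: F_def dpow_0_right grad_lin grad_mult)
    show "F (i + 1) (Suc t) = grad (F i (Suc t)) + D (F i t)" for i t
    proof -
      \<comment> \<open>\<open>h\<close> collects the \<open>grad\<close> part of the recursion in
        the first factor. Expanding its second factor too yields the term
        \<open>grad b * D c\<close> of the super Leibniz rule.\<close>
      define h where "h r = grad (dpow i r b) * dpow (i + 1 - int r) (Suc t - r) c" for r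
      have h1: "h r = grad (dpow i r b * dpow (i - int r) (Suc t - r) c) + grad (dpow i r b) * D (dpow (i - int r) (t - r) c)"
        if "r \<le> t" for r
      proof -
        have e: "i + 1 - int r = (i - int r) + 1" "Suc t - r = Suc (t - r)" using that by auto
        show ?thesis unfolding h_def e dpow_Suc grad_mult distrib_left ..
      qed
      have h2: "h (Suc t) = grad (dpow i (Suc t) b * dpow (i - int (Suc t)) 0 c)"
      proof -
        have "i + 1 - int (Suc t) = (i - int (Suc t)) + 1" by simp
        then show ?thesis unfolding h_def by (simp only: dpow_Suc_0 grad_mult diff_self_eq_0)
      qed
      have "(\<Sum>r\<le>Suc t. dpow (i + 1) r b * dpow (i + 1 - int r) (Suc t - r) c)
          = (\<Sum>r\<le>Suc t. h r) + (\<Sum>r\<le>t. D (dpow i r b) * dpow (i - int r) (t - r) c)"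
        unfolding sum.atMost_Suc_shift[of _ t]
        by (simp add: dpow_Suc_0 dpow_Suc h_def distrib_right sum.distrib)
      also have "\<dots> = grad (\<Sum>r\<le>Suc t. dpow i r b * dpow (i - int r) (Suc t - r) c)
          + D (\<Sum>r\<le>t. dpow i r b * dpow (i - int r) (t - r) c)"
        by (simp add: h1 h2 grad_lin D_lin D_mult sum.distrib algebra_simps)
      finally show ?thesis
        by (simp only: F_def dpow_Suc grad_lin D_lin) simp
    qed
  qed
  then show ?thesis by (simp add: F_def)
qed

section \<open>The ring of super pseudodifferential operators\<close>

text \<open>The coefficient of \<open>\<D>\<^sup>n\<close> in \<open>\<D>\<^sup>i f \<D>\<^sup>j\<close>.\<close>

definition opcoeff :: "int \<Rightarrow> int \<Rightarrow> int \<Rightarrow> 'k::field_char_0 sdpoly \<Rightarrow> 'k sdpoly" where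
  "opcoeff n i j f = (if n \<le> i + j then dpow i (nat (i + j - n)) f else 0)"

lemma linear_opcoeff: "linear_sd (opcoeff n i j)"
  by (simp add: linear_sd_def opcoeff_def dpow_lin)

lemmas opcoeff_lin = linear_sdD[OF linear_opcoeff]

lemma pcoeff_simps [simp]:
  "pcoeff 0 k = 0" "pcoeff (P + Q) k = pcoeff P k + pcoeff Q k" "pcoeff (- P) k = - pcoeff P k"
  "pcoeff (P - Q) k = pcoeff P k - pcoeff Q k"
  using plus_psdo.rep_eq[of P "- Q"]
  by (simp_all add: zero_psdo.rep_eq plus_psdo.rep_eq uminus_psdo.rep_eq)

lemma psdo_eqI: "(\<And>k. pcoeff P k = pcoeff Q k) \<Longrightarrow> P = Q"
  by (simp add: pcoeff_inject[symmetric] fun_eq_iff)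

lemma pcoeff_sum: "pcoeff (\<Sum>x\<in>A. h x) k = (\<Sum>x\<in>A. pcoeff (h x) k)"
  by (induction A rule: infinite_finite_induct) auto

section \<open>Orders of operators and products as finite sums\<close>

definition ord_le :: "'k::field_char_0 psdo \<Rightarrow> int \<Rightarrow> bool" where
  "ord_le P m \<longleftrightarrow> (\<forall>k>m. pcoeff P k = 0)"

lemma ex_ord_le: "\<exists>m. ord_le P m"
  using psdo_bound[of P] by (simp add: ord_le_def)

lemma ord_le_mono: "ord_le P m \<Longrightarrow> m \<le> m' \<Longrightarrow> ord_le P m'"
  by (simp add: ord_le_def)

text \<open>Replaces the support-dependent index set of the product by a rectangle: a nonzero term
  has n \<le> i + j, which bounds both indices below. The freedom in \<open>a\<close> and
  \<open>b\<close> lets different products share one rectangle.\<close>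

lemma pcoeff_times:
  assumes P: "ord_le P M" and Q: "ord_le Q N" and "a \<le> n - N" "b \<le> n - M"
  shows "pcoeff (P * Q) n = (\<Sum>i=a..M. \<Sum>j=b..N. pcoeff P i * opcoeff n i j (pcoeff Q j))"
proof -
  let ?S = "{(i, r). pcoeff P i \<noteq> 0 \<and> pcoeff Q (n - i + int r) \<noteq> 0}"
  let ?g = "\<lambda>(i, r). (i, n - i + int r)"
  have le: "i \<le> M" "j \<le> N" if "pcoeff P i \<noteq> 0" "pcoeff Q j \<noteq> 0" for i j
    using that P Q by (force simp: ord_le_def not_less[symmetric])+
  have "pcoeff (P * Q) n = (\<Sum>(i, r)\<in>?S. pcoeff P i * dpow i r (pcoeff Q (n - i + int r)))"
    by (simp add: times_psdo.rep_eq dpow_def times_linear split_def)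
  also have "\<dots> = (\<Sum>(i, j)\<in>?g ` ?S. pcoeff P i * opcoeff n i j (pcoeff Q j))"
    by (subst sum.reindex) (auto simp: inj_on_def opcoeff_def intro!: sum.cong)
  also have "\<dots> = (\<Sum>(i, j)\<in>{a..M} \<times> {b..N}. pcoeff P i * opcoeff n i j (pcoeff Q j))"
  proof (rule sum.mono_neutral_left)
    show "?g ` ?S \<subseteq> {a..M} \<times> {b..N}"
      using le assms(3,4) by force
    show "\<forall>x\<in>{a..M} \<times> {b..N} - ?g ` ?S. (case x of (i, j) \<Rightarrow> pcoeff P i * opcoeff n i j (pcoeff Q j)) = 0"
    proof (clarsimp)
      fix i j assume *: "(i, j) \<notin> ?g ` ?S"
      show "pcoeff P i * opcoeff n i j (pcoeff Q j) = 0"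
      proof (cases "n \<le> i + j \<and> pcoeff P i \<noteq> 0 \<and> pcoeff Q j \<noteq> 0")
        case True
        then have "(i, nat (i + j - n)) \<in> ?S" "?g (i, nat (i + j - n)) = (i, j)" by auto
        with * show ?thesis by (metis (no_types, lifting) image_eqI)
      next
        case False
        then show ?thesis by (auto simp: opcoeff_def dpow_lin)
      qed
    qed
  qed simp
  finally show ?thesis by (simp add: sum.cartesian_product)
qed

lemma ord_le_times: "ord_le P M \<Longrightarrow> ord_le Q N \<Longrightarrow> ord_le (P * Q) (M + N)"
  unfolding ord_le_def[of "P * Q"]
  by (auto simp: pcoeff_times[OF _ _ order_refl order_refl] opcoeff_def intro!: sum.neutral)

text \<open>Associativity for monomial operators: both sums are the coefficient of
  \<open>D\<close>^n in \<open>D\<close>^i b \<open>D\<close>^j c \<open>D\<close>^k, bracketed in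
  the two ways. The range of \<open>m\<close> contains every nonzero term.\<close>

lemma opcoeff_assoc:
  assumes "i \<le> N" "j \<le> N" "k \<le> N"
  shows "(\<Sum>m=n-N..2*N. opcoeff m i j b * opcoeff n m k c) = (\<Sum>m=n-N..2*N. opcoeff n i m (b * opcoeff m j k c))"
proof (cases "n \<le> i + j + k")
  case False
  then have "opcoeff m i j b * opcoeff n m k c = 0" "opcoeff n i m (b * opcoeff m j k c) = 0" for m
    by (auto simp: opcoeff_def dpow_lin)
  then show ?thesis by simp
next
  case True
  \<comment> \<open>\<open>T\<close> is the total number of derivatives falling on \<open>b\<close>
    and \<open>c\<close>; both sums become sums over the number falling on \<open>b\<close>.\<close>
  define T where "T = nat (i + j + k - n)"
  have T: "int T = i + j + k - n" using True by (simp add: T_def)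
  have "(\<Sum>m=n-N..2*N. opcoeff m i j b * opcoeff n m k c) = (\<Sum>m=n-k..i+j. opcoeff m i j b * opcoeff n m k c)"
    using assms by (intro sum.mono_neutral_right) (auto simp: opcoeff_def)
  also have "\<dots> = (\<Sum>r\<le>T. dpow i r b * dpow (i + j - int r) (T - r) c)"
  proof (rule sum.reindex_bij_witness[of _ "\<lambda>r. i + j - int r" "\<lambda>m. nat (i + j - m)"])
    fix m assume m: "m \<in> {n-k..i+j}"
    have "nat (m + k - n) = T - nat (i + j - m)" using m T by auto
    then show "dpow i (nat (i + j - m)) b * dpow (i + j - int (nat (i + j - m))) (T - nat (i + j - m)) c =
        opcoeff m i j b * opcoeff n m k c"
      using m by (simp add: opcoeff_def)
  qed (use T in auto)
  finally have L: "(\<Sum>m=n-N..2*N. opcoeff m i j b * opcoeff n m k c) = (\<Sum>r\<le>T. dpow i r b * dpow (i + j - int r) (T - r) c)" .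
  have "(\<Sum>m=n-N..2*N. opcoeff n i m (b * opcoeff m j k c)) = (\<Sum>m=n-i..j+k. opcoeff n i m (b * opcoeff m j k c))"
    using assms by (intro sum.mono_neutral_right) (auto simp: opcoeff_def dpow_lin)
  also have "\<dots> = (\<Sum>u\<le>T. dpow i (T - u) (b * dpow j u c))"
  proof (rule sum.reindex_bij_witness[of _ "\<lambda>u. j + k - int u" "\<lambda>m. nat (j + k - m)"])
    fix m assume m: "m \<in> {n-i..j+k}"
    have "nat (i + m - n) = T - nat (j + k - m)" using m T by auto
    then show "dpow i (T - nat (j + k - m)) (b * dpow j (nat (j + k - m)) c) = opcoeff n i m (b * opcoeff m j k c)"
      using m by (simp add: opcoeff_def)
  qed (use T in auto)
  also have "\<dots> = (\<Sum>u\<le>T. \<Sum>r\<le>T - u. dpow i r b * dpow (i - int r) (T - u - r) (dpow j u c))"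
    by (simp add: dpow_mult)
  also have "\<dots> = (\<Sum>r\<le>T. \<Sum>u\<le>T - r. dpow i r b * dpow (i - int r) (T - u - r) (dpow j u c))"
    by (subst (1 2) sum.Sigma) (auto intro!: sum.reindex_bij_witness[of _ prod.swap prod.swap])
  also have "\<dots> = (\<Sum>r\<le>T. dpow i r b * dpow (i + j - int r) (T - r) c)"
  proof (rule sum.cong)
    fix r
    have "(\<Sum>u\<le>T - r. dpow (i - int r) (T - u - r) (dpow j u c)) = (\<Sum>v\<le>T - r. dpow (i - int r) v (dpow j (T - r - v) c))"
    proof (rule sum.reindex_bij_witness[of _ "\<lambda>v. T - r - v" "\<lambda>v. T - r - v"])
      fix u assume "u \<in> {..T - r}"
      then have e: "T - r - (T - r - u) = u" "T - r - u = T - u - r" by auto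
      show "dpow (i - int r) (T - r - u) (dpow j (T - r - (T - r - u)) c) = dpow (i - int r) (T - u - r) (dpow j u c)"
        unfolding e(1) unfolding e(2) ..
    qed auto
    then show "(\<Sum>u\<le>T - r. dpow i r b * dpow (i - int r) (T - u - r) (dpow j u c)) = dpow i r b * dpow (i + j - int r) (T - r) c"
      unfolding sum_distrib_left[symmetric] dpow_dpow by (simp add: dpow_dpow algebra_simps)
  qed simp
  finally show ?thesis unfolding L by simp
qed

lemma pcoeff_fop_times: "pcoeff (fop f * Q) n = f * pcoeff Q n"
proof -
  obtain N where N: "ord_le Q N" using ex_ord_le by blast
  have f: "ord_le (fop f) 0" by (simp add: ord_le_def fop.rep_eq)
  have N': "ord_le Q (max N n)" using N by (rule ord_le_mono) simp
  have "pcoeff (fop f * Q) n = (\<Sum>i=n - max N n..0. \<Sum>j=n..max N n. pcoeff (fop f) i * opcoeff n i j (pcoeff Q j))"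
    by (rule pcoeff_times[OF f N']) auto
  also have "\<dots> = (\<Sum>i\<in>{0::int}. \<Sum>j\<in>{n}. pcoeff (fop f) i * opcoeff n i j (pcoeff Q j))"
    by (intro sum.mono_neutral_cong_right sum.neutral ballI) (auto simp: fop.rep_eq opcoeff_def dpow_0)
  finally show ?thesis by (simp add: fop.rep_eq opcoeff_def dpow_0)
qed

lemma grad_one [simp]: "grad (1 :: 'k::comm_ring_1 sdpoly) = 1"
  by (simp add: one_sdpoly_def grad_monom fcard.rep_eq)

lemma D_one [simp]: "D (1 :: 'k::comm_ring_1 sdpoly) = 0"
  using D_mult[of "1 :: 'k sdpoly" 1] by simp

lemma dpow_one: "dpow i r 1 = (if r = 0 then 1 else 0)"
proof (cases r)
  case (Suc s)
  have "(D ^^ r) 1 = (0 :: 'a sdpoly)" unfolding Suc funpow_Suc_right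
    by (simp add: linear_sdD[OF linear_funpow_D])
  then show ?thesis using Suc by (simp add: dpow_def grad_lin)
qed (simp add: dpow_0_right)

lemma pcoeff_times_Dop: "pcoeff (P * Dop m) n = pcoeff P (n - m)"
proof -
  obtain M where "ord_le P M" using ex_ord_le by blast
  then have M: "ord_le P (max M (n - m))" by (rule ord_le_mono) simp
  have D: "ord_le (Dop m) m" by (simp add: ord_le_def Dop.rep_eq)
  have "pcoeff (P * Dop m) n = (\<Sum>i=n - m..max M (n - m). \<Sum>j=min m (n - max M (n - m))..m. pcoeff P i * opcoeff n i j (pcoeff (Dop m) j))"
    by (rule pcoeff_times[OF M D]) auto
  also have "\<dots> = (\<Sum>i\<in>{n - m}. \<Sum>j\<in>{m}. pcoeff P i * opcoeff n i j (pcoeff (Dop m) j))"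
    by (intro sum.mono_neutral_cong_right sum.neutral ballI) (auto simp: Dop.rep_eq opcoeff_def dpow_one dpow_lin)
  finally show ?thesis by (simp add: Dop.rep_eq opcoeff_def dpow_one)
qed

lemma fop_1: "fop 1 = 1"
  by (rule psdo_eqI) (simp add: one_psdo_def fop.rep_eq Dop.rep_eq)

lemma sum_rotate:
  "(\<Sum>a\<in>A. \<Sum>b\<in>B. \<Sum>c\<in>C. f a b c) = (\<Sum>b\<in>B. \<Sum>c\<in>C. \<Sum>a\<in>A. f a b c)"
  by (subst sum.swap) (intro sum.cong refl sum.swap)

instance psdo :: (field_char_0) ring_1
proof
  fix P Q R :: "'a psdo"
  obtain M1 M2 M3 where "ord_le P M1" "ord_le Q M2" "ord_le R M3" using ex_ord_le by metis
  then have "ord_le P (max M1 (max M2 M3))" "ord_le Q (max M1 (max M2 M3))" "ord_le R (max M1 (max M2 M3))"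
    by (auto elim!: ord_le_mono)
  then obtain N where N: "ord_le P N" "ord_le Q N" "ord_le R N" by blast
  have N2: "ord_le (P * Q) (2 * N)" "ord_le (Q * R) (2 * N)"
    using ord_le_times[OF N(1,2)] ord_le_times[OF N(2,3)] by simp_all
  show "P * Q * R = P * (Q * R)"
  proof (rule psdo_eqI)
    fix n
    \<comment> \<open>One range for the indices of all three factors. The lower bound n - 2 N
      suffices for every inner product coefficient because m \<ge> n - N on
      \<open>?M\<close>.\<close>
    let ?I = "{n - 2 * N..N}" and ?M = "{n - N..2 * N}"
    let ?l = "\<lambda>i j k m. pcoeff P i * opcoeff m i j (pcoeff Q j) * opcoeff n m k (pcoeff R k)"
    let ?r = "\<lambda>i j k m. pcoeff P i * opcoeff n i m (pcoeff Q j * opcoeff m j k (pcoeff R k))"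
    have "pcoeff (P * Q * R) n = (\<Sum>m\<in>?M. \<Sum>k\<in>?I. pcoeff (P * Q) m * opcoeff n m k (pcoeff R k))"
      by (rule pcoeff_times[OF N2(1) N(3)]) auto
    also have "\<dots> = (\<Sum>m\<in>?M. \<Sum>k\<in>?I. (\<Sum>i\<in>?I. \<Sum>j\<in>?I. pcoeff P i * opcoeff m i j (pcoeff Q j)) * opcoeff n m k (pcoeff R k))"
      by (intro sum.cong refl arg_cong2[of _ _ _ _ "(*)"] pcoeff_times[OF N(1,2)]) auto
    also have "\<dots> = (\<Sum>m\<in>?M. \<Sum>k\<in>?I. \<Sum>i\<in>?I. \<Sum>j\<in>?I. ?l i j k m)"
      by (simp add: sum_distrib_right)
    also have "\<dots> = (\<Sum>k\<in>?I. \<Sum>i\<in>?I. \<Sum>m\<in>?M. \<Sum>j\<in>?I. ?l i j k m)"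
      by (rule sum_rotate)
    also have "\<dots> = (\<Sum>i\<in>?I. \<Sum>m\<in>?M. \<Sum>k\<in>?I. \<Sum>j\<in>?I. ?l i j k m)"
      by (rule sum_rotate)
    also have "\<dots> = (\<Sum>i\<in>?I. \<Sum>k\<in>?I. \<Sum>j\<in>?I. \<Sum>m\<in>?M. ?l i j k m)"
      by (intro sum.cong refl sum_rotate)
    also have "\<dots> = (\<Sum>i\<in>?I. \<Sum>k\<in>?I. \<Sum>j\<in>?I. \<Sum>m\<in>?M. ?r i j k m)"
      unfolding mult.assoc sum_distrib_left[symmetric]
      by (intro sum.cong refl arg_cong2[of _ _ _ _ "(*)"] opcoeff_assoc) auto
    also have "\<dots> = (\<Sum>i\<in>?I. \<Sum>j\<in>?I. \<Sum>m\<in>?M. \<Sum>k\<in>?I. ?r i j k m)"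
      by (intro sum.cong refl sum_rotate)
    also have "\<dots> = (\<Sum>i\<in>?I. \<Sum>m\<in>?M. \<Sum>j\<in>?I. \<Sum>k\<in>?I. ?r i j k m)"
      by (intro sum.cong refl sum.swap)
    also have "\<dots> = (\<Sum>i\<in>?I. \<Sum>m\<in>?M. pcoeff P i * opcoeff n i m (\<Sum>j\<in>?I. \<Sum>k\<in>?I. pcoeff Q j * opcoeff m j k (pcoeff R k)))"
      by (simp add: opcoeff_lin sum_distrib_left)
    also have "\<dots> = (\<Sum>i\<in>?I. \<Sum>m\<in>?M. pcoeff P i * opcoeff n i m (pcoeff (Q * R) m))"
      by (intro sum.cong refl arg_cong2[of _ _ _ _ "(*)"] arg_cong[of _ _ "opcoeff _ _ _"] pcoeff_times[OF N(2,3), symmetric]) auto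
    also have "\<dots> = pcoeff (P * (Q * R)) n"
      by (rule pcoeff_times[OF N(1) N2(2), symmetric]) auto
    finally show "pcoeff (P * Q * R) n = pcoeff (P * (Q * R)) n" .
  qed
  have PQ: "ord_le (P + Q) N" "ord_le (Q + R) N" using N by (simp_all add: ord_le_def)
  show "(P + Q) * R = P * R + Q * R"
    by (rule psdo_eqI)
       (simp add: pcoeff_times[OF PQ(1) N(3) order_refl order_refl] pcoeff_times[OF N(1) N(3) order_refl order_refl]
         pcoeff_times[OF N(2) N(3) order_refl order_refl] distrib_right sum.distrib)
  show "P * (Q + R) = P * Q + P * R"
    by (rule psdo_eqI)
       (simp add: pcoeff_times[OF N(1) PQ(2) order_refl order_refl] pcoeff_times[OF N(1) N(2) order_refl order_refl]
         pcoeff_times[OF N(1) N(3) order_refl order_refl] opcoeff_lin distrib_left sum.distrib)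
  show "1 * P = P"
    unfolding fop_1[symmetric] by (rule psdo_eqI) (simp add: pcoeff_fop_times)
  show "P * 1 = P"
    unfolding one_psdo_def by (rule psdo_eqI) (simp add: pcoeff_times_Dop)
  have "pcoeff (0 :: 'a psdo) 0 \<noteq> pcoeff 1 0" by (simp add: one_psdo_def Dop.rep_eq)
  then show "(0 :: 'a psdo) \<noteq> 1" by metis
qed

text \<open>The possible \<open>grad\<close> comes from moving \<open>D\<close>^M past the leading
  coefficient of \<open>Q\<close>.\<close>

lemma pcoeff_times_top:
  assumes "ord_le P M" "ord_le Q N"
  shows "pcoeff (P * Q) (M + N) = pcoeff P M * (if even M then pcoeff Q N else grad (pcoeff Q N))"
  using pcoeff_times[OF assms, of M "M + N" N] by (simp add: opcoeff_def dpow_0_right)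

lemma ord_le_simps:
  "ord_le P m \<Longrightarrow> ord_le Q m \<Longrightarrow> ord_le (P + Q) m"
  "ord_le P m \<Longrightarrow> ord_le Q m \<Longrightarrow> ord_le (P - Q) m"
  by (simp_all add: ord_le_def)

lemma ord_le_fop: "ord_le (fop f) 0"
  by (simp add: ord_le_def fop.rep_eq)

lemma ord_le_less: "ord_le P m \<Longrightarrow> pcoeff P m = 0 \<Longrightarrow> ord_le P (m - 1)"
  unfolding ord_le_def
proof (intro allI impI)
  fix k assume "\<forall>k>m. pcoeff P k = 0" "pcoeff P m = 0" "k > m - 1"
  then show "pcoeff P k = 0" by (cases "k = m") auto
qed

lemma ex_leading:
  assumes "pcoeff P k \<noteq> 0"
  obtains m where "k \<le> m" "ord_le P m" "pcoeff P m \<noteq> 0"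
proof -
  obtain N where N: "ord_le P N" using ex_ord_le by blast
  let ?A = "{m. k \<le> m \<and> pcoeff P m \<noteq> 0}"
  have "?A \<subseteq> {k..N}" using N by (force simp: ord_le_def not_less[symmetric])
  then have fin: "finite ?A" by (rule finite_subset) simp
  moreover have "k \<in> ?A" using assms by simp
  ultimately have "Max ?A \<in> ?A" using Max_in by blast
  moreover have "ord_le P (Max ?A)"
    unfolding ord_le_def
  proof (intro allI impI)
    fix l assume "Max ?A < l"
    then have "l \<notin> ?A" using fin by (meson Max_ge not_le)
    moreover have "k \<le> l" using \<open>Max ?A < l\<close> \<open>Max ?A \<in> ?A\<close> by auto
    ultimately show "pcoeff P l = 0" by blast
  qed
  ultimately show ?thesis using that by blast
qed

lemma Dop_add: "Dop (a + b) = Dop a * Dop b"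
  by (rule psdo_eqI) (auto simp: pcoeff_times_Dop Dop.rep_eq)

lemma Dop_power: "Dop 1 ^ n = Dop (int n)"
  by (induction n) (simp_all add: one_psdo_def flip: Dop_add)

section \<open>Cube roots\<close>

definition monic_ord1 :: "'k::field_char_0 psdo \<Rightarrow> bool" where
  "monic_ord1 P \<longleftrightarrow> ord_le P 1 \<and> pcoeff P 1 = 1"

text \<open>Allowing two operators \<open>P\<close> and \<open>Q\<close> makes \<open>Y\<close> an
  exact difference of cubes when \<open>X\<close> is their difference. The middle term contributes
  \<open>grad\<close> because one \<open>D\<close> passes the leading coefficient; in the last term
  two passes cancel.\<close>

lemma cube_variation:
  assumes "monic_ord1 P" "monic_ord1 Q" "ord_le X m"
  defines "Y \<equiv> X * P * P + Q * X * P + Q * Q * X"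
  shows "ord_le Y (m + 2)" "pcoeff Y (m + 2) = pcoeff X m + pcoeff X m + grad (pcoeff X m)"
proof -
  have P: "ord_le P 1" "pcoeff P 1 = 1" and Q: "ord_le Q 1" "pcoeff Q 1 = 1"
    using assms by (auto simp: monic_ord1_def)
  note X = assms(3)
  have XP: "ord_le (X * P) (m + 1)" "pcoeff (X * P) (m + 1) = pcoeff X m"
    using ord_le_times[OF X P(1)] pcoeff_times_top[OF X P(1)] P(2) by simp_all
  have QX: "ord_le (Q * X) (m + 1)" "pcoeff (Q * X) (m + 1) = grad (pcoeff X m)"
    using ord_le_times[OF Q(1) X] pcoeff_times_top[OF Q(1) X] Q(2) by (simp_all add: add.commute)
  have QQ: "ord_le (Q * Q) 2" "pcoeff (Q * Q) 2 = 1"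
    using ord_le_times[OF Q(1) Q(1)] pcoeff_times_top[OF Q(1) Q(1)] Q(2) by simp_all
  have 1: "ord_le (X * P * P) (m + 2)" "pcoeff (X * P * P) (m + 2) = pcoeff X m"
    using ord_le_times[OF XP(1) P(1)] pcoeff_times_top[OF XP(1) P(1)] P(2) XP(2) by (simp_all add: add.assoc)
  have 2: "ord_le (Q * X * P) (m + 2)" "pcoeff (Q * X * P) (m + 2) = grad (pcoeff X m)"
    using ord_le_times[OF QX(1) P(1)] pcoeff_times_top[OF QX(1) P(1)] P(2) QX(2) by (simp_all add: add.assoc)
  have 3: "ord_le (Q * Q * X) (m + 2)" "pcoeff (Q * Q * X) (m + 2) = pcoeff X m"
    using ord_le_times[OF QQ(1) X] pcoeff_times_top[OF QQ(1) X] QQ(2) by (simp_all add: add.commute)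
  show "ord_le Y (m + 2)" "pcoeff Y (m + 2) = pcoeff X m + pcoeff X m + grad (pcoeff X m)"
    using 1 2 3 by (simp_all add: Y_def ord_le_simps)
qed

lemma sdpoly_double_cancel: "f + f = 0 \<Longrightarrow> f = 0" for f :: "'k::field_char_0 sdpoly"
proof (rule sdpoly_eqI)
  fix m assume "f + f = 0"
  then have "mcoeff (f + f) m = 0" by simp
  then have "2 * mcoeff f m = 0" by (simp only: mcoeff_simps mult_2)
  then show "mcoeff f m = mcoeff 0 m" by simp
qed

text \<open>Applying the involution \<open>grad\<close> gives a second linear equation in
  \<open>f\<close> and \<open>grad f\<close>; the system has determinant 3.\<close>

lemma two_plus_grad_cancel:
  fixes f :: "'k::field_char_0 sdpoly"
  assumes "f + f + grad f = 0"
  shows "f = 0"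
proof (rule sdpoly_eqI)
  fix m
  have "grad f + grad f + f = 0" using arg_cong[OF assms, of grad] by (simp add: grad_lin)
  then have "mcoeff (f + f + grad f) m = 0" "mcoeff (grad f + grad f + f) m = 0"
    using assms by (simp_all only: mcoeff_simps(1))
  then have "3 * mcoeff f m = 0" by (simp only: mcoeff_simps) algebra
  then show "mcoeff f m = mcoeff 0 m" by simp
qed

lemma cube_variation_eq_0:
  assumes "monic_ord1 P" "monic_ord1 Q" "X * P * P + Q * X * P + Q * Q * X = 0"
  shows "X = 0"
proof (rule ccontr)
  assume "X \<noteq> 0"
  then obtain k where "pcoeff X k \<noteq> 0" using psdo_eqI[of X 0] by auto
  then obtain m where m: "ord_le X m" "pcoeff X m \<noteq> 0" by (rule ex_leading)
  then show False
    using cube_variation(2)[OF assms(1,2) m(1)] assms(3) two_plus_grad_cancel by fastforce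
qed

lemma diff_cubes: "P ^ 3 - Q ^ 3 = (P - Q) * P * P + Q * (P - Q) * P + Q * Q * (P - Q)"
  for P Q :: "'a::ring_1"
  by (simp add: power3_eq_cube algebra_simps)

lemma cube_root_unique:
  "monic_ord1 P \<Longrightarrow> monic_ord1 Q \<Longrightarrow> P ^ 3 = Q ^ 3 \<Longrightarrow> P = Q"
  using cube_variation_eq_0[of P Q "P - Q"] diff_cubes[of P Q] by simp

text \<open>
  Adding \<open>a \<D>\<^sup>-\<^sup>n\<close> changes the coefficient of \<open>\<D>\<^sup>2\<^sup>-\<^sup>n\<close> in the cube by \<open>2 a + grad a\<close>, and
  \<open>e \<mapsto> (2 e - grad e) / 3\<close> inverts \<open>a \<mapsto> 2 a + grad a\<close>.
\<close>

primrec cube_root_approx :: "'k::field_char_0 psdo \<Rightarrow> nat \<Rightarrow> 'k psdo" where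
  "cube_root_approx S 0 = Dop 1"
| "cube_root_approx S (Suc n) = cube_root_approx S n +
     (let e = pcoeff (S - cube_root_approx S n ^ 3) (2 - int n)
      in fop ((1 / 3) \<cdot> (e + e - grad e)) * Dop (- int n))"

lemma cube_root_approx:
  assumes S: "ord_le S 3" "pcoeff S 3 = 1"
  shows "monic_ord1 (cube_root_approx S n) \<and> ord_le (S - cube_root_approx S n ^ 3) (2 - int n)"
proof (induction n)
  case 0
  have "ord_le (S - Dop 3) (3 - 1)"
    using S by (intro ord_le_less) (simp_all add: ord_le_def Dop.rep_eq)
  then show ?case by (simp add: monic_ord1_def ord_le_def Dop.rep_eq Dop_power[of 3, simplified])
next
  case (Suc n)
  define P where "P = cube_root_approx S n"
  define e where "e = pcoeff (S - P ^ 3) (2 - int n)"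
  define X where "X = fop ((1 / 3) \<cdot> (e + e - grad e)) * Dop (- int n)"
  have P: "monic_ord1 P" "ord_le (S - P ^ 3) (2 - int n)" using Suc by (simp_all add: P_def)
  have X: "ord_le X (- int n)" "pcoeff X (- int n) = (1 / 3) \<cdot> (e + e - grad e)"
    by (simp_all add: X_def ord_le_def pcoeff_fop_Dop)
  have PX: "monic_ord1 (P + X)"
    using P(1) X(1) by (simp add: monic_ord1_def ord_le_def)
  let ?Y = "X * (P + X) * (P + X) + P * X * (P + X) + P * P * X"
  \<comment> \<open>\<open>diff_cubes\<close> for P + X and P expresses the change of the cube
    exactly, so no quadratic remainder has to be estimated.\<close>
  have Y: "(P + X) ^ 3 = P ^ 3 + ?Y"
    using diff_cubes[of "P + X" P] by (simp add: algebra_simps)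
  have c: "pcoeff X (- int n) + pcoeff X (- int n) + grad (pcoeff X (- int n)) = e"
    unfolding X(2)
  proof (rule sdpoly_eqI)
    fix m
    show "mcoeff ((1 / 3) \<cdot> (e + e - grad e) + (1 / 3) \<cdot> (e + e - grad e) + grad ((1 / 3) \<cdot> (e + e - grad e))) m = mcoeff e m"
      unfolding grad_lin grad_grad mcoeff_simps mcoeff_scal by (simp add: field_simps)
  qed
  have "ord_le ?Y (2 - int n)" "pcoeff ?Y (2 - int n) = e"
    using cube_variation[OF PX P(1) X(1)] c by simp_all
  then have "ord_le (S - (P + X) ^ 3) (2 - int n)" "pcoeff (S - (P + X) ^ 3) (2 - int n) = 0"
    using P(2) unfolding Y e_def by (simp_all add: ord_le_def)
  then have "ord_le (S - (P + X) ^ 3) (2 - int n - 1)" by (rule ord_le_less)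
  moreover have "cube_root_approx S (Suc n) = P + X"
    by (simp add: P_def X_def e_def Let_def)
  ultimately show ?case using PX by (simp add: algebra_simps)
qed

text \<open>Passing from stage \<open>m\<close> to the next changes only the coefficient of order
  -m. Hence every coefficient is eventually constant and a formal limit exists.\<close>

lemma cube_root_approx_stable:
  assumes "n \<le> m"
  shows "ord_le (cube_root_approx S m - cube_root_approx S n) (- int n)"
  using assms
proof (induction m rule: dec_induct)
  case (step m)
  let ?X = "cube_root_approx S (Suc m) - cube_root_approx S m"
  have "ord_le ?X (- int m)"
    by (simp add: ord_le_def pcoeff_fop_Dop Let_def)
  then have "ord_le ?X (- int n)" by (rule ord_le_mono) (use step.hyps in simp)
  from ord_le_simps(1)[OF this step.IH] show ?case by (simp del: cube_root_approx.simps)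
qed (simp add: ord_le_def)

lemma ex_cube_root:
  assumes S: "ord_le S 3" "pcoeff S 3 = 1"
  shows "\<exists>P. monic_ord1 P \<and> P ^ 3 = S"
proof -
  let ?A = "cube_root_approx S"
  \<comment> \<open>The coefficient of order \<open>k\<close> is final from the first stage n with
    -n < k onwards, namely 1 - k, or 0 for positive \<open>k\<close>.\<close>
  let ?c = "\<lambda>k. pcoeff (?A (nat (1 - k))) k"
  define P where "P = Psdo ?c"
  have "\<exists>N. \<forall>k>N. ?c k = 0"
    by (rule exI[of _ 1]) (simp add: Dop.rep_eq)
  then have P: "pcoeff P k = ?c k" for k
    unfolding P_def by (subst Psdo_inverse) auto
  have close: "ord_le (P - ?A n) (- int n)" for n
    unfolding ord_le_def
  proof (intro allI impI)
    fix k assume k: "- int n < k"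
    then have "nat (1 - k) \<le> n" by simp
    from cube_root_approx_stable[OF this, of S] have "ord_le (?A n - ?A (nat (1 - k))) (k - 1)"
      by (rule ord_le_mono) simp
    then show "pcoeff (P - ?A n) k = 0" by (simp add: P ord_le_def)
  qed
  have monic: "monic_ord1 P"
    unfolding monic_ord1_def ord_le_def
    by (auto simp: P Dop.rep_eq)
  have "P ^ 3 - S = 0"
  proof (rule psdo_eqI)
    fix k
    \<comment> \<open>At this stage both errors, of P^3 and of S against the cube of the
      approximation, have order below \<open>k\<close>.\<close>
    define n where "n = nat (3 - k)"
    then have n: "2 - int n < k" by simp
    have A: "monic_ord1 (?A n)" "ord_le (S - ?A n ^ 3) (2 - int n)"
      using cube_root_approx[OF S] by blast+
    have "ord_le (P ^ 3 - ?A n ^ 3) (- int n + 2)"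
      unfolding diff_cubes by (rule cube_variation(1)[OF monic A(1) close])
    with A(2) show "pcoeff (P ^ 3 - S) k = pcoeff 0 k"
      using n by (simp add: ord_le_def)
  qed
  then show ?thesis using monic by auto
qed

section \<open>Coefficientwise maps\<close>

lemma pcoeff_pmap: "linear_sd h \<Longrightarrow> pcoeff (pmap h P) k = h (pcoeff P k)"
proof -
  assume "linear_sd h"
  then have "h 0 = 0" by (rule linear_sdD)
  moreover obtain N where "\<forall>k>N. pcoeff P k = 0" using psdo_bound by blast
  ultimately have "\<exists>N. \<forall>k>N. h (pcoeff P k) = 0" by (intro exI[of _ N]) simp
  then show ?thesis unfolding pmap_def by (subst Psdo_inverse) auto
qed

lemma ord_le_pmap: "linear_sd h \<Longrightarrow> ord_le P m \<Longrightarrow> ord_le (pmap h P) m"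
  by (simp add: ord_le_def pcoeff_pmap linear_sdD)

lemma opcoeff_commute:
  assumes h: "linear_sd h" and "\<And>f. h (D f) = D (h f)" "\<And>f. h (grad f) = grad (h f)"
  shows "h (opcoeff n i j f) = opcoeff n i j (h f)"
proof -
  have "h ((D ^^ r) f) = (D ^^ r) (h f)" for r by (induction r) (simp_all add: assms)
  then show ?thesis by (simp add: opcoeff_def dpow_def linear_sdD[OF h] assms)
qed

lemma ex_common_ord_le: "\<exists>m. ord_le P m \<and> ord_le Q m"
proof -
  obtain M N where "ord_le P M" "ord_le Q N" using ex_ord_le by metis
  then have "ord_le P (max M N)" "ord_le Q (max M N)" by (auto elim!: ord_le_mono)
  then show ?thesis by blast
qed

text \<open>Coefficients of a product are linear combinations of products of coefficients and their
  images under \<open>D\<close> and \<open>grad\<close>, so a linear map respecting these operations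
  lifts to operators. It is applied to \<open>aug\<close>.\<close>

lemma pmap_mult:
  assumes h: "linear_sd h" and "\<And>f. h (D f) = D (h f)" "\<And>f. h (grad f) = grad (h f)"
    and mult: "\<And>f g. h (f * g) = h f * h g"
  shows "pmap h (P * Q) = pmap h P * pmap h Q"
proof (rule psdo_eqI)
  fix n
  obtain N where N: "ord_le P N" "ord_le Q N" using ex_common_ord_le by blast
  show "pcoeff (pmap h (P * Q)) n = pcoeff (pmap h P * pmap h Q) n"
    by (simp add: pcoeff_pmap[OF h] pcoeff_times[OF N order_refl order_refl] mult
        pcoeff_times[OF ord_le_pmap[OF h N(1)] ord_le_pmap[OF h N(2)] order_refl order_refl]
        linear_sdD[OF h] opcoeff_commute[OF assms(1-3)])
qed

lemma pmap_derivation: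
  assumes h: "linear_sd h" and "\<And>f. h (D f) = D (h f)" "\<And>f. h (grad f) = grad (h f)"
    and mult: "\<And>f g. h (f * g) = h f * g + f * h g"
  shows "pmap h (P * Q) = pmap h P * Q + P * pmap h Q"
proof (rule psdo_eqI)
  fix n
  obtain N where N: "ord_le P N" "ord_le Q N" using ex_common_ord_le by blast
  show "pcoeff (pmap h (P * Q)) n = pcoeff (pmap h P * Q + P * pmap h Q) n"
    by (simp add: pcoeff_pmap[OF h] pcoeff_times[OF N order_refl order_refl] mult
        pcoeff_times[OF ord_le_pmap[OF h N(1)] N(2) order_refl order_refl]
        pcoeff_times[OF N(1) ord_le_pmap[OF h N(2)] order_refl order_refl]
        linear_sdD[OF h] opcoeff_commute[OF assms(1-3)] sum.distrib)
qed

text \<open>The parity automorphism of the operator ring; the sign accounts for the parity of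
  \<open>D\<close>^k. Being multiplicative, it tracks parity through products more directly than the
  projections \<open>ppart\<close>.\<close>

lift_definition pgrad :: "'k::field_char_0 psdo \<Rightarrow> 'k psdo"
  is "\<lambda>P k. (if even k then 1 else - 1) \<cdot> grad (P k)"
proof -
  fix P :: "int \<Rightarrow> 'k sdpoly"
  assume "\<exists>N. \<forall>k>N. P k = 0"
  then obtain N where "\<forall>k>N. P k = 0" by blast
  then show "\<exists>N. \<forall>k>N. (if even k then 1 else - 1) \<cdot> grad (P k) = 0"
    by (intro exI[of _ N]) (simp add: grad_lin)
qed

lemma ord_le_pgrad: "ord_le P m \<Longrightarrow> ord_le (pgrad P) m"
  by (simp add: ord_le_def pgrad.rep_eq grad_lin)

lemma grad_funpow_D: "grad ((D ^^ r) f) = (if even r then 1 else - 1) \<cdot> (D ^^ r) (grad f)"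
  by (induction r) (simp_all add: grad_D D_lin)

text \<open>The sign counts the i + j - n derivatives, each anticommuting with
  \<open>grad\<close>.\<close>

lemma grad_opcoeff: "grad (opcoeff n i j f) = (if even (i + j + n) then 1 else - 1) \<cdot> opcoeff n i j (grad f)"
proof (cases "n \<le> i + j")
  case True
  then have "even (nat (i + j - n)) \<longleftrightarrow> even (i + j + n)" by (simp add: even_nat_iff)
  then show ?thesis using True
    by (simp add: opcoeff_def dpow_def grad_lin grad_funpow_D)
qed (simp add: opcoeff_def grad_lin)

lemma pgrad_mult: "pgrad (P * Q) = pgrad P * pgrad Q"
proof (rule psdo_eqI)
  fix n
  obtain N where N: "ord_le P N" "ord_le Q N" using ex_common_ord_le by blast
  show "pcoeff (pgrad (P * Q)) n = pcoeff (pgrad P * pgrad Q) n"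
    by (auto simp: pgrad.rep_eq pcoeff_times[OF N order_refl order_refl] grad_lin grad_mult grad_opcoeff
        pcoeff_times[OF ord_le_pgrad[OF N(1)] ord_le_pgrad[OF N(2)] order_refl order_refl]
        times_linear opcoeff_lin scal_sum intro!: sum.cong)
qed

lemma pgrad_lin [simp]: "pgrad (P + Q) = pgrad P + pgrad Q" "pgrad (P - Q) = pgrad P - pgrad Q"
  "pgrad (- P) = - pgrad P" "pgrad 0 = 0"
  by (rule psdo_eqI, simp add: pgrad.rep_eq grad_lin)+

lemma pgrad_pgrad [simp]: "pgrad (pgrad P) = P"
  by (rule psdo_eqI) (simp add: pgrad.rep_eq grad_lin)

lemma pgrad_fop: "pgrad (fop f) = fop (grad f)"
  by (rule psdo_eqI) (simp add: pgrad.rep_eq fop.rep_eq grad_lin)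

lemma pgrad_Dop: "pgrad (Dop m) = (if even m then Dop m else - Dop m)"
  by (rule psdo_eqI) (simp add: pgrad.rep_eq Dop.rep_eq grad_lin)

lemma pgrad_one [simp]: "pgrad 1 = 1"
  by (simp add: one_psdo_def pgrad_Dop)

lemma pgrad_power: "pgrad (P ^ n) = pgrad P ^ n"
  by (induction n) (simp_all add: pgrad_mult)

section \<open>Homogeneity as an eigenvalue condition, and the supercommutator\<close>

lemma part_eq_iff: "part p f = f \<longleftrightarrow> grad f = (if even p then f else - f)" for f :: "'k::field_char_0 sdpoly"
proof -
  have pp: "part 0 f + part 1 f = f" "grad f = part 0 f - part 1 f"
    by (simp_all only: part_add_part grad_def)
  have "part p f = (if even p then part 0 f else part 1 f)"
    by (subst part_mod) (auto simp: even_iff_mod_2_eq_zero odd_iff_mod_2_eq_one)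
  moreover have "part 0 f = f \<longleftrightarrow> grad f = f"
  proof
    assume "part 0 f = f" then show "grad f = f" using pp by (metis add_cancel_left_right diff_zero)
  next
    assume "grad f = f"
    then have "(part 0 f + part 1 f) - (part 0 f - part 1 f) = 0" using pp by simp
    then have "part 1 f + part 1 f = 0" by simp
    then have "part 1 f = 0" by (rule sdpoly_double_cancel)
    then show "part 0 f = f" using pp by simp
  qed
  moreover have "part 1 f = f \<longleftrightarrow> grad f = - f"
  proof
    assume "part 1 f = f" then show "grad f = - f" using pp by (metis add_cancel_right_left diff_0)
  next
    assume "grad f = - f"
    then have "(part 0 f + part 1 f) + (part 0 f - part 1 f) = 0" using pp by simp
    then have "part 0 f + part 0 f = 0" by simp
    then have "part 0 f = 0" by (rule sdpoly_double_cancel)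
    then show "part 1 f = f" using pp by simp
  qed
  ultimately show ?thesis by simp
qed

lemma ppart_eq_iff: "ppart p P = P \<longleftrightarrow> pgrad P = (if even p then P else - P)"
proof -
  have "pgrad P = (if even p then P else - P) \<longleftrightarrow>
      (\<forall>k. pcoeff (pgrad P) k = pcoeff (if even p then P else - P) k)"
    by (metis psdo_eqI)
  also have "\<dots> \<longleftrightarrow> (\<forall>k. part (p + nat \<bar>k\<bar>) (pcoeff P k) = pcoeff P k)"
    unfolding part_eq_iff
    by (intro iff_allI) (auto simp: pgrad.rep_eq even_nat_iff, (metis minus_minus)+)
  also have "\<dots> \<longleftrightarrow> ppart p P = P"
    by (metis psdo_eqI ppart.rep_eq)
  finally show ?thesis by simp
qed

lemma part_part: "part p (part q f) = (if even (p + q) then part q f else 0)"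
  by (rule linear_sd_eqI[of "\<lambda>f. part p (part q f)" "\<lambda>f. if even (p + q) then part q f else 0"])
     (auto simp: part_monom linear_sd_def linear_sdD[OF linear_part])

text \<open>The odd component of \<open>A\<close> vanishes, so no term with a plus sign survives and
  the two components of \<open>X\<close> recombine.\<close>

lemma scomm_even:
  assumes "ppart 0 A = A"
  shows "scomm A X = A * X - X * A"
proof -
  have 1: "ppart (Suc 0) A = 0"
    by (subst assms[symmetric], rule psdo_eqI) (simp add: ppart.rep_eq part_part)
  have "ppart 0 X + ppart (Suc 0) X = X"
  proof (rule psdo_eqI)
    fix k
    have e: "part (nat \<bar>k\<bar>) f + part (Suc (nat \<bar>k\<bar>)) f = f" for f :: "'a sdpoly"
    proof (cases "even k")
      case True
      then have "part (nat \<bar>k\<bar>) f = part 0 f" "part (Suc (nat \<bar>k\<bar>)) f = part 1 f"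
        by (auto intro!: fun_cong[OF part_cong] simp: even_nat_iff)
      then show ?thesis by (simp only: part_add_part)
    next
      case False
      then have "part (nat \<bar>k\<bar>) f = part 1 f" "part (Suc (nat \<bar>k\<bar>)) f = part 0 f"
        by (auto intro!: fun_cong[OF part_cong] simp: even_nat_iff)
      then show ?thesis by (simp only: part_add_part add.commute[of "part 1 f"])
    qed
    show "pcoeff (ppart 0 X + ppart (Suc 0) X) k = pcoeff X k"
      by (simp add: ppart.rep_eq e)
  qed
  then show ?thesis
    by (simp add: scomm_def numeral_2_eq_2 assms 1 algebra_simps)
       (metis distrib_left distrib_right add.commute)
qed

section \<open>The kernel of the super derivative\<close>

lemma pd_one: "pd k 1 = 0"
  by (simp add: one_sdpoly_def pd_def Let_def)

lemma grad_gen: "grad (gen k) = (if even k then - 1 else 1) \<cdot> gen k"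
  by (auto simp: gen_def grad_monom fcard.rep_eq)

lemma pd_gen_mult:
  "pd k (gen l * f) = (if k = l then f else 0) + (if even k \<and> even l then - 1 else 1) \<cdot> (gen l * pd k f)"
  by (auto simp: pd_mult pd_gen grad_gen times_linear)

text \<open>Serves to show that a generator absent from \<open>f\<close> is also absent from the
  partial derivatives of \<open>f\<close>.\<close>

lemma pd_pd: "pd j (pd k f) = (if even j \<and> even k then - 1 else 1) \<cdot> pd k (pd j f)"
proof -
  let ?h = "\<lambda>f. pd j (pd k f) - (if even j \<and> even k then - 1 else 1) \<cdot> pd k (pd j f)"
  note lin' = linear_sdD[OF linear_pd]
  have "?h f = 0"
  proof (rule sdpoly_gen_induct[of ?h])
    show "linear_sd ?h" by (auto simp: linear_sd_def lin')
    show "?h 1 = 0" by (simp add: pd_one lin')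
    fix l g assume "?h g = 0"
    then have IH: "pd j (pd k g) = (if even j \<and> even k then - 1 else 1) \<cdot> pd k (pd j g)" by simp
    have e: "pd i (pd i' (gen l * g)) = (if i' = l then pd i g else 0)
        + (if even i' \<and> even l then - 1 else 1) \<cdot> ((if i = l then pd i' g else 0)
        + (if even i \<and> even l then - 1 else 1) \<cdot> (gen l * pd i (pd i' g)))" for i i'
      by (auto simp: pd_gen_mult lin')
    show "?h (gen l * g) = 0"
      unfolding e IH by (auto simp: times_linear)
  qed
  then show ?thesis by simp
qed

text \<open>If \<open>\<D>\<^sup>k\<phi>\<close> is the highest generator occurring in \<open>f\<close>, then \<open>\<D>\<^sup>k\<^sup>+\<^sup>1\<phi>\<close> occurs in \<open>\<D>f\<close>.\<close>

lemma D_eq_0_imp_pd_eq_0: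
  assumes "D f = 0"
  shows "pd k f = 0"
proof (rule ccontr)
  let ?K = "{k. pd k f \<noteq> 0}"
  assume "pd k f \<noteq> 0"
  then have K: "?K \<noteq> {}" by blast
  define m where "m = Max ?K"
  have m: "m \<in> ?K" unfolding m_def by (rule Max_in[OF finite_pd K])
  have "Suc m \<notin> ?K" using Max_ge[OF finite_pd, of "Suc m" f] unfolding m_def[symmetric] by linarith
  then have z: "pd (Suc m) f = 0" by simp
  have "pd (Suc m) (pd j f) = 0" for j
    using pd_pd[of "Suc m" j f] by (simp add: z linear_sdD[OF linear_pd])
  \<comment> \<open>The generator after the highest one of \<open>f\<close> enters
    \<open>D f\<close> only through the explicit factor \<open>gen (Suc j)\<close> with j =
    m.\<close>
  then have "pd (Suc m) (gen (Suc j) * pd j f) = (if m = j then pd j f else 0)" for j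
    by (simp add: pd_gen_mult times_linear)
  then have "pd (Suc m) (D f) = (\<Sum>j\<in>?K. if m = j then pd j f else 0)"
    by (simp add: D_def evolutionary_def linear_sdD[OF linear_pd])
  also have "\<dots> = pd m f" using m by (simp add: sum.delta)
  finally show False using assms m by (simp add: linear_sdD[OF linear_pd])
qed

lemma mcoeff_linear:
  assumes "linear_sd h"
  shows "mcoeff (h f) m = (\<Sum>n\<in>support f. mcoeff f n * mcoeff (h (monom n)) m)"
proof -
  have "mcoeff (h f) m = mcoeff (h (\<Sum>n\<in>support f. mcoeff f n \<cdot> monom n)) m"
    by (rule arg_cong[OF sdpoly_expand[of f], of "\<lambda>x. mcoeff (h x) m"])
  then show ?thesis by (simp add: linear_sdD[OF assms] mcoeff_sum)
qed

lemma mcoeff_linear_single: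
  assumes "linear_sd h" "\<And>n. n \<noteq> p \<Longrightarrow> mcoeff (h (monom n)) m = 0"
  shows "mcoeff (h f) m = mcoeff f p * mcoeff (h (monom p)) m"
proof -
  have "mcoeff (h f) m = (\<Sum>n\<in>support f. if p = n then mcoeff f p * mcoeff (h (monom p)) m else 0)"
    unfolding mcoeff_linear[OF assms(1), of f] by (intro sum.cong) (auto simp: assms(2))
  then show ?thesis by (auto simp: sum.delta in_support_iff)
qed

text \<open>The constant term, kept inside the algebra so that it is an endomorphism to which
  \<open>pmap\<close> applies.\<close>

definition aug :: "'k::comm_ring_1 sdpoly \<Rightarrow> 'k sdpoly" where
  "aug f = mcoeff f ({#}, {||}) \<cdot> 1"

text \<open>Differentiate along a generator of a nonconstant monomial: at the quotient monomial only
  this monomial contributes, with a sign or a multiplicity as factor. Characteristic zero keeps the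
  multiplicity nonzero.\<close>

lemma pd_eq_0_imp_constant:
  fixes f :: "'k::field_char_0 sdpoly"
  assumes "\<And>k. pd k f = 0"
  shows "f = aug f"
proof (rule sdpoly_eqI)
  fix m :: smono
  obtain B F where m: "m = (B, F)" by (cases m)
  have "mcoeff f m = 0" if "m \<noteq> ({#}, {||})"
  proof -
    have "(\<exists>i B'. B = add_mset i B') \<or> (\<exists>i. i |\<in>| F)"
      using that m by (cases B) auto
    then consider i B' where "B = add_mset i B'" | i where "i |\<in>| F" by blast
    then show ?thesis
    proof cases
      case 1
      have "mcoeff (pd (2 * i + 1) f) (B', F) = mcoeff f (B, F) * mcoeff (pd (2 * i + 1) (monom (B, F))) (B', F)"
      proof (rule mcoeff_linear_single[OF linear_pd])
        fix n :: smono assume n: "n \<noteq> (B, F)"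
        obtain C G where [simp]: "n = (C, G)" by (cases n)
        have "C = add_mset i (C - {#i#})" if "i \<in># C" using that by simp
        with n show "mcoeff (pd (2 * i + 1) (monom n)) (B', F) = (0 :: 'k)"
          by (cases "i \<in># C") (auto simp: pd_monom_odd mcoeff_mono 1 not_in_iff)
      qed
      also have "mcoeff (pd (2 * i + 1) (monom (B, F))) (B', F) = (of_nat (count B i) :: 'k)"
        by (simp add: pd_monom_odd mcoeff_mono 1)
      finally have "mcoeff f (B, F) * of_nat (count B i) = 0" using assms by simp
      moreover have "(of_nat (count B i) :: 'k) \<noteq> 0" unfolding 1 by (simp del: of_nat_Suc)
      ultimately have "mcoeff f (B, F) = 0" by (metis mult_eq_0_iff)
      then show ?thesis using m by simp
    next
      case 2
      let ?G = "F |-| {|i|}"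
      have "mcoeff (pd (2 * i) f) (B, ?G) = mcoeff f (B, F) * mcoeff (pd (2 * i) (monom (B, F))) (B, ?G)"
      proof (rule mcoeff_linear_single[OF linear_pd])
        fix n :: smono assume n: "n \<noteq> (B, F)"
        obtain C G where [simp]: "n = (C, G)" by (cases n)
        have "G = F" if "i |\<in>| G" "?G = G |-| {|i|}" using that 2 by (metis finsert_fminus)
        with n show "mcoeff (pd (2 * i) (monom n)) (B, ?G) = (0 :: 'k)"
          by (auto simp: pd_monom_even mcoeff_mono)
      qed
      then show ?thesis using 2 m assms by (simp add: pd_monom_even mcoeff_mono)
    qed
  qed
  then show "mcoeff f m = mcoeff (aug f) m"
    by (auto simp: aug_def one_sdpoly_def mcoeff_mono)
qed

lemma linear_aug: "linear_sd aug"
  by (simp add: linear_sd_def aug_def)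

lemmas aug_lin = linear_sdD[OF linear_aug]

lemma aug_monom: "aug (monom m) = (if m = ({#}, {||}) then 1 else 0)"
  by (auto simp: aug_def mcoeff_mono)

lemma aug_mult: "aug (f * g) = aug f * aug g"
proof (rule bilinear_sd_eqI[of "\<lambda>f g. aug (f * g)" "\<lambda>f g. aug f * aug g"])
  show "aug (monom m * monom n) = aug (monom m) * (aug (monom n) :: 'a sdpoly)" for m n
    by (auto simp: mono_times_mono aug_lin aug_monom mono_join_def mono_sign_def prod_eq_iff)
qed (simp_all add: linear_sd_def aug_lin times_linear)

lemma aug_gen [simp]: "aug (gen k) = 0"
  by (simp add: gen_def aug_monom)

lemma aug_D [simp]: "aug (D f) = 0"
  by (simp add: D_def evolutionary_def aug_lin aug_mult)

lemma aug_one [simp]: "aug 1 = 1"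
  by (simp add: one_sdpoly_def aug_monom)

lemma D_aug [simp]: "D (aug f) = 0"
  by (simp add: aug_def D_lin)

lemma grad_aug [simp]: "grad (aug f) = aug f"
  by (simp add: aug_def grad_lin)

lemma aug_grad [simp]: "aug (grad f) = aug f"
  by (rule linear_sd_eqI[of "\<lambda>f. aug (grad f)" aug])
     (auto simp: linear_sd_def grad_lin aug_lin grad_monom aug_monom fcard.rep_eq)

lemma D_eq_0_imp_constant: "D f = 0 \<Longrightarrow> f = aug f" for f :: "'k::field_char_0 sdpoly"
  by (intro pd_eq_0_imp_constant D_eq_0_imp_pd_eq_0)

lemma D_aug_eq_0_imp_eq_0: "D f = 0 \<Longrightarrow> aug f = 0 \<Longrightarrow> f = 0" for f :: "'k::field_char_0 sdpoly"
  using D_eq_0_imp_constant by metis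

section \<open>The trace property of the super residue\<close>

lemma range_D_add: "f \<in> range D \<Longrightarrow> g \<in> range D \<Longrightarrow> f + g \<in> range D"
  by (elim rangeE) (simp flip: D_lin)

lemma range_D_scal: "f \<in> range D \<Longrightarrow> c \<cdot> f \<in> range D"
  by (elim rangeE) (simp flip: D_lin)

definition pgradn :: "nat \<Rightarrow> 'k::field_char_0 psdo \<Rightarrow> 'k psdo" where
  "pgradn p P = (if even p then P else pgrad P)"

lemma pgradn_mult: "pgradn p (P * Q) = pgradn p P * pgradn p Q"
  by (simp add: pgradn_def pgrad_mult)

text \<open>\<open>A Q - pgradn p Q A\<close> is the supercommutator, for \<open>A\<close> of parity \<open>p\<close> and arbitrary \<open>Q\<close>.\<close>

definition trace_like :: "nat \<Rightarrow> 'k::field_char_0 psdo \<Rightarrow> bool" where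
  "trace_like p A \<longleftrightarrow> pgrad A = (if even p then A else - A) \<and> (\<forall>Q. sres (A * Q - pgradn p Q * A) \<in> range D)"

lemma sres_simps: "sres (P + Q) = sres P + sres Q" "sres (P - Q) = sres P - sres Q" "sres (- P) = - sres P"
  by (simp_all add: sres_def)

text \<open>\<open>[A B, Q] = [A, B Q] \<plusminus> [B, Q A]\<close>\<close>

lemma trace_like_mult:
  assumes A: "trace_like p A" and B: "trace_like q B"
  shows "trace_like (p + q) (A * B)"
proof -
  have gr: "pgrad (A * B) = (if even (p + q) then A * B else - (A * B))"
    using A B by (auto simp: trace_like_def pgrad_mult)
  have "sres (A * B * Q - pgradn (p + q) Q * (A * B)) \<in> range D" for Q
  proof -
    let ?s = "if even (p * q) then 1 else - 1 :: 'a"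
    have "pgradn p B * X = (if even (p * q) then B * X else - (B * X))" for X
      using B by (auto simp: pgradn_def trace_like_def)
    then have "sres (A * B * Q - pgradn (p + q) Q * (A * B)) = sres (A * (B * Q) - pgradn p (B * Q) * A)
        + ?s \<cdot> sres (B * (pgradn p Q * A) - pgradn q (pgradn p Q * A) * B)"
      using A by (auto simp: pgradn_mult mult.assoc sres_simps) (auto simp: pgradn_def trace_like_def mult.assoc sres_simps)
    then show ?thesis
      using A B by (simp add: trace_like_def range_D_add range_D_scal del: scal_simps)
  qed
  with gr show ?thesis by (simp add: trace_like_def)
qed

section \<open>The trace property for functions and powers of \<open>D\<close>\<close>

lemma sbinom_int:
  "sbinom (int m) r = (if even m \<and> odd r then 0 else of_nat (m div 2 choose (r div 2)))"
proof -
  have "int m div 2 = int (m div 2)" by simp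
  then show ?thesis by (simp only: sbinom_def binomial_gbinomial even_of_nat of_int_of_nat_eq)
qed

lemma sbinom_eq_0: "m < r \<Longrightarrow> sbinom (int m) r = 0"
proof -
  assume r: "m < r"
  show ?thesis
  proof (cases "even m \<and> odd r")
    case False
    with r have "m div 2 < r div 2" by presburger
    then show ?thesis by (simp add: sbinom_int binomial_eq_0)
  qed (simp add: sbinom_def)
qed

lemma dpow_eq_0: "0 \<le> i \<Longrightarrow> i < int r \<Longrightarrow> dpow i r f = 0"
  by (elim nonneg_int_cases) (simp add: dpow_def sbinom_eq_0)

text \<open>\<open>D\<close>^i f has no negative powers for i \<ge> 0 and has order below -1 for i <
  -1, so only the \<open>D\<close>^(-1) term of \<open>P\<close> contributes.\<close>

lemma sres_times_fop: "sres (P * fop f) = sres P * grad f"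
proof -
  obtain M where "ord_le P M" using ex_ord_le by blast
  then have M: "ord_le P (max M 0)" by (rule ord_le_mono) simp
  have "pcoeff (P * fop f) (- 1) = (\<Sum>i=-1..max M 0. \<Sum>j=min 0 (-1 - max M 0)..0. pcoeff P i * opcoeff (-1) i j (pcoeff (fop f) j))"
    by (rule pcoeff_times[OF M ord_le_fop]) auto
  also have "\<dots> = (\<Sum>i\<in>{-1}. \<Sum>j\<in>{0}. pcoeff P i * opcoeff (-1) i j (pcoeff (fop f) j))"
    by (intro sum.mono_neutral_cong_right sum.neutral ballI)
       (auto simp: fop.rep_eq opcoeff_def dpow_eq_0 dpow_lin)
  finally show ?thesis by (simp add: sres_def fop.rep_eq opcoeff_def dpow_0_right)
qed

text \<open>Here the residue is zero outright, by supercommutativity of the coefficient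
  algebra.\<close>

lemma trace_like_fop:
  assumes "part p f = f"
  shows "trace_like p (fop f)"
proof -
  have gr: "grad f = (if even p then f else - f)" using assms by (simp add: part_eq_iff)
  have "sres (fop f * Q - pgradn p Q * fop f) = D 0" for Q
    using homogeneous_commute[OF assms, of "sres Q"]
    by (auto simp: sres_simps sres_times_fop gr pgradn_def)
       (auto simp: sres_def pcoeff_fop_times pgrad.rep_eq D_lin)
  moreover have "pgrad (fop f) = (if even p then fop f else - fop f)"
    by (rule psdo_eqI) (simp add: pgrad_fop gr fop.rep_eq)
  ultimately show ?thesis unfolding trace_like_def by (metis rangeI)
qed

lemma Dop_1_times: "pcoeff (Dop 1 * Q) n = grad (pcoeff Q (n - 1)) + D (pcoeff Q n)"
proof -
  obtain N where "ord_le Q N" using ex_ord_le by blast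
  then have N: "ord_le Q (max N n)" by (rule ord_le_mono) simp
  have D1: "ord_le (Dop 1) 1" by (simp add: ord_le_def Dop.rep_eq)
  have s: "opcoeff n 1 j f = (if j = n - 1 then grad f else if j = n then D f else 0)" if "j \<le> n" for j and f :: "'a sdpoly"
  proof -
    have "j = n - 1 \<or> j = n \<or> j < n - 1" using that by presburger
    then show ?thesis
      by (auto simp: opcoeff_def dpow_def sbinom_def)
  qed
  have s': "opcoeff n 1 j f = 0" if "n < j" for j and f :: "'a sdpoly"
  proof -
    define r where "r = nat (1 + j - n)"
    have "r \<ge> 2" using that by (simp add: r_def)
    then have "r div 2 \<noteq> 0" by simp
    then have "sbinom 1 r = (0 :: 'a)" by (simp add: sbinom_def gbinomial_0_left)
    then show ?thesis using that by (simp add: opcoeff_def dpow_def r_def)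
  qed
  have "pcoeff (Dop 1 * Q) n = (\<Sum>i=min 1 (n - max N n)..1. \<Sum>j=n - 1..max N n. pcoeff (Dop 1) i * opcoeff n i j (pcoeff Q j))"
    by (rule pcoeff_times[OF D1 N]) auto
  also have "\<dots> = (\<Sum>i\<in>{1}. \<Sum>j\<in>{n - 1, n}. pcoeff (Dop 1) i * opcoeff n i j (pcoeff Q j))"
    by (intro sum.mono_neutral_cong_right sum.neutral ballI) (auto simp: Dop.rep_eq s')
  finally show ?thesis by (simp add: Dop.rep_eq s)
qed

text \<open>The order -2 coefficient of \<open>Q\<close> cancels and \<open>D (sres Q)\<close>
  remains; this is the source of the total derivative.\<close>

lemma trace_like_Dop1: "trace_like 1 (Dop 1)"
  by (auto simp: trace_like_def pgrad_Dop sres_def Dop_1_times pcoeff_times_Dop pgradn_def pgrad.rep_eq)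

lemma trace_like_Dop: "trace_like n (Dop (int n))"
proof (induction n)
  case 0
  have "part 0 (1 :: 'a sdpoly) = 1" by (simp add: one_sdpoly_def part_monom fcard.rep_eq)
  then show ?case using trace_like_fop[of 0 "1 :: 'a sdpoly"] by (simp add: fop_1 one_psdo_def)
next
  case (Suc n)
  then show ?case using trace_like_mult[OF trace_like_Dop1 Suc] by (simp flip: Dop_add)
qed

lemma trace_like_sum:
  assumes "\<And>x. x \<in> X \<Longrightarrow> trace_like p (A x)"
  shows "trace_like p (\<Sum>x\<in>X. A x)"
  using assms
proof (induction X rule: infinite_finite_induct)
  case (insert x X)
  have "sres ((a + b) * Q - pgradn p Q * (a + b)) = sres (a * Q - pgradn p Q * a) + sres (b * Q - pgradn p Q * b)"
    for a b Q :: "'b psdo"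
    by (simp add: sres_simps algebra_simps)
  then have "trace_like p (a + b)" if "trace_like p a" "trace_like p b" for a b :: "'b psdo"
    using that by (auto simp: trace_like_def intro: range_D_add)
  with insert show ?case by simp
qed (auto simp: trace_like_def sres_def pgradn_def intro: range_eqI[of _ _ 0] simp: D_lin)

section \<open>The trace property for differential operators\<close>

lemma differential_expand:
  assumes "plus_part P = P"
  obtains N where "P = (\<Sum>k\<le>N. fop (pcoeff P (int k)) * Dop (int k))"
proof -
  obtain N where N: "ord_le P N" using ex_ord_le by blast
  have neg: "pcoeff P n = 0" if "n < 0" for n
    using plus_part.rep_eq[of P] assms that by (metis not_le)
  have "P = (\<Sum>k\<le>nat N. fop (pcoeff P (int k)) * Dop (int k))"
  proof (rule psdo_eqI)
    fix n
    have "pcoeff (\<Sum>k\<le>nat N. fop (pcoeff P (int k)) * Dop (int k)) n = (\<Sum>k\<le>nat N. if k = nat n then (if 0 \<le> n then pcoeff P n else 0) else 0)"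
      unfolding pcoeff_sum pcoeff_fop_Dop by (intro sum.cong) auto
    also have "\<dots> = pcoeff P n"
      using N neg by (auto simp: sum.delta ord_le_def)
    finally show "pcoeff P n = pcoeff (\<Sum>k\<le>nat N. fop (pcoeff P (int k)) * Dop (int k)) n" by simp
  qed
  then show ?thesis by (rule that)
qed

lemma sres_commutator_differential:
  assumes "plus_part A = A" "ppart 0 A = A"
  shows "sres (A * Q - Q * A) \<in> range D"
proof -
  obtain N where A: "A = (\<Sum>k\<le>N. fop (pcoeff A (int k)) * Dop (int k))"
    using differential_expand[OF assms(1)] .
  have "trace_like 0 (fop (pcoeff A (int k)) * Dop (int k))" for k
  proof -
    have "part k (pcoeff A (int k)) = pcoeff A (int k)"
      using ppart.rep_eq[of 0 A] assms(2) by (metis abs_of_nat add_0 nat_int)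
    \<comment> \<open>In an even operator the coefficient of \<open>D\<close>^k has the parity of
      \<open>k\<close>, so each term has parity k + k and is even.\<close>
    then have "trace_like (k + k) (fop (pcoeff A (int k)) * Dop (int k))"
      by (intro trace_like_mult trace_like_fop trace_like_Dop)
    then show ?thesis by (simp add: trace_like_def pgradn_def)
  qed
  then have "trace_like 0 A" by (subst A) (rule trace_like_sum)
  then show ?thesis by (simp add: trace_like_def pgradn_def)
qed

section \<open>The root of the Lax operator\<close>

lemma ord_le_lax_sqrt: "ord_le lax_sqrt 3" "pcoeff lax_sqrt 3 = 1"
  by (simp_all add: lax_sqrt_def ord_le_def Dop.rep_eq fop.rep_eq)

lemma pgrad_lax_sqrt: "pgrad lax_sqrt = - lax_sqrt"
  by (rule psdo_eqI) (simp add: lax_sqrt_def pgrad.rep_eq Dop.rep_eq fop.rep_eq grad_gen grad_lin)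

lemma monic_ord1_iff: "monic_ord1 P \<longleftrightarrow> (\<forall>k>0. pcoeff (P - Dop 1) k = 0)"
proof -
  have "k > 0 \<longleftrightarrow> k = 1 \<or> k > 1" for k :: int by linarith
  then show ?thesis by (auto simp: monic_ord1_def ord_le_def Dop.rep_eq)
qed

text \<open>Since \<open>lax_sqrt\<close> is odd, \<open>- pgrad R\<close> is again a monic cube
  root, and uniqueness makes the root odd. This supplies the parity clause in the definite
  description of \<open>lax_root\<close>.\<close>

lemma lax_root:
  "monic_ord1 (lax_root :: 'k::field_char_0 psdo)"
  "lax_root ^ 3 = (lax_sqrt :: 'k psdo)"
  "pgrad lax_root = (- lax_root :: 'k psdo)"
proof -
  obtain R where R: "monic_ord1 R" "R ^ 3 = (lax_sqrt :: 'k psdo)"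
    using ex_cube_root[OF ord_le_lax_sqrt] by blast
  have "monic_ord1 (- pgrad R)"
    using R(1) by (simp add: monic_ord1_def ord_le_def pgrad.rep_eq grad_lin)
  moreover have "(- pgrad R) ^ 3 = - pgrad (R ^ 3)"
    by (simp add: pgrad_mult power3_eq_cube)
  then have "(- pgrad R) ^ 3 = R ^ 3"
    by (simp add: R(2) pgrad_lax_sqrt)
  ultimately have odd: "- pgrad R = R" using R(1) cube_root_unique by blast
  then have "pgrad R = - R" by (metis minus_minus)
  then have "ppart 1 R = R" by (simp add: ppart_eq_iff)
  then have "lax_root = R"
    unfolding lax_root_def monic_ord1_iff[symmetric]
    using R by (intro the_equality) (blast, metis cube_root_unique)
  then show "monic_ord1 (lax_root :: 'k psdo)" "lax_root ^ 3 = (lax_sqrt :: 'k psdo)" "pgrad lax_root = (- lax_root :: 'k psdo)"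
    using R \<open>pgrad R = - R\<close> by simp_all
qed

lemma pmap_aug_mult: "pmap aug (P * Q) = pmap aug P * pmap aug Q"
  by (rule pmap_mult) (simp_all add: linear_aug aug_mult)

lemma pmap_aug_power: "pmap aug (P ^ n) = pmap aug P ^ n"
proof (induction n)
  case 0
  show ?case by (rule psdo_eqI) (simp add: pcoeff_pmap[OF linear_aug] one_psdo_def Dop.rep_eq aug_lin)
qed (simp add: pmap_aug_mult)

text \<open>Taking constant terms is multiplicative and sends \<open>lax_sqrt\<close> to
  \<open>D\<close>^3, whose only monic cube root is \<open>D\<close>.\<close>

lemma aug_lax_root_power: "aug (pcoeff (lax_root ^ n) k) = (if k = int n then 1 else 0)"
proof -
  have "monic_ord1 (pmap aug (lax_root :: 'a psdo))"
    using lax_root(1)[where 'k='a] by (simp add: monic_ord1_def ord_le_def pcoeff_pmap[OF linear_aug] aug_lin)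
  moreover have "monic_ord1 (Dop 1 :: 'a psdo)"
    by (simp add: monic_ord1_def ord_le_def Dop.rep_eq)
  moreover have "pmap aug (lax_root :: 'a psdo) ^ 3 = Dop 1 ^ 3"
    unfolding pmap_aug_power[symmetric] lax_root(2) Dop_power
    by (rule psdo_eqI) (simp add: pcoeff_pmap[OF linear_aug] lax_sqrt_def Dop.rep_eq fop.rep_eq aug_lin)
  ultimately have "pmap aug (lax_root :: 'a psdo) = Dop 1" by (rule cube_root_unique)
  then have "pmap aug ((lax_root :: 'a psdo) ^ n) = Dop (int n)" by (simp add: pmap_aug_power Dop_power)
  then show ?thesis by (metis pcoeff_pmap[OF linear_aug] Dop.rep_eq)
qed

lemma lax_root_power_commute: "lax_root ^ n * lax_sqrt = lax_sqrt * lax_root ^ n"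
  unfolding lax_root(2)[symmetric] by (simp add: power_add[symmetric] add.commute)

section \<open>Commutators with \<open>lax_sqrt\<close>\<close>

lemma Dop_3_times:
  "pcoeff (Dop 3 * Q) n = grad (pcoeff Q (n - 3)) + D (pcoeff Q (n - 2))
     + grad (dx (pcoeff Q (n - 1))) + D (dx (pcoeff Q n))"
proof -
  have "Dop 3 * Q = Dop 1 * (Dop 1 * (Dop 1 * Q))"
    unfolding mult.assoc[symmetric] by (simp flip: Dop_add)
  then show ?thesis by (simp add: Dop_1_times D_lin grad_lin grad_D)
qed

lemma commutator_lax_sqrt:
  "pcoeff (Q * lax_sqrt - lax_sqrt * Q) n = pcoeff Q (n - 3) - grad (pcoeff Q (n - 3)) - D (pcoeff Q (n - 2))
     - grad (dx (pcoeff Q (n - 1))) - D (dx (pcoeff Q n)) + pcoeff (Q * fop \<phi>) n - \<phi> * pcoeff Q n"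
  by (simp add: lax_sqrt_def distrib_left distrib_right pcoeff_times_Dop Dop_3_times pcoeff_fop_times)

lemma sdpoly_triple_cancel: "f + f + f = 0 \<Longrightarrow> f = 0" for f :: "'k::field_char_0 sdpoly"
proof (rule sdpoly_eqI)
  fix m assume "f + f + f = 0"
  then have "mcoeff (f + f + f) m = 0" by simp
  then have "3 * mcoeff f m = 0" unfolding mcoeff_simps by algebra
  then show "mcoeff f m = mcoeff 0 m" by simp
qed

lemma commutator_lax_sqrt_ord_le_0:
  assumes even: "pgrad R = R" and aug: "\<And>k. aug (pcoeff R k) = 0"
    and comm: "ord_le (R * lax_sqrt - lax_sqrt * R) 0"
  shows "ord_le R (- 1)"
  unfolding ord_le_def
proof (intro allI impI, rule ccontr)
  fix k :: int assume "- 1 < k" "pcoeff R k \<noteq> 0"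
  then obtain m where m: "0 \<le> m" "ord_le R m" "pcoeff R m \<noteq> 0"
    using ex_leading[of R k] by force
  have gr: "grad (pcoeff R j) = (if even j then pcoeff R j else - pcoeff R j)" for j
    using arg_cong[OF even, of "\<lambda>P. pcoeff P j"] by (auto simp: pgrad.rep_eq) (metis minus_minus)
  have "ord_le (R * fop \<phi>) m" using ord_le_times[OF m(2) ord_le_fop, of \<phi>] by simp
  \<comment> \<open>Above order \<open>m\<close> all terms with \<phi> drop out, as does the third
    derivative, so only the commutator with \<open>D\<close>^3 is left.\<close>
  then have eq: "pcoeff R (n - 3) - grad (pcoeff R (n - 3)) - D (pcoeff R (n - 2)) - grad (dx (pcoeff R (n - 1))) = 0"
    if "m < n" for n
    using commutator_lax_sqrt[of R n] comm m that by (simp add: ord_le_def D_lin)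
  show False
  proof (cases "even m")
    case True
    \<comment> \<open>With r and s the coefficients of order m and m - 1, order m + 2 gives 2 s = D
      r and order m + 1 gives D s + r_x = 0; together 3 D s = 0, hence r_x = 0.\<close>
    let ?x = "D (pcoeff R (m - 1))" and ?y = "dx (pcoeff R m)"
    have "pcoeff R (m - 1) + pcoeff R (m - 1) = D (pcoeff R m)"
      using eq[of "m + 2"] m(2) True by (simp add: gr ord_le_def D_lin grad_lin)
    then have "?x + ?x = ?y" by (metis D_lin(1))
    moreover have "?x + ?y = 0"
      using eq[of "m + 1"] True by (simp add: gr grad_D D_lin) (metis add_eq_0_iff diff_eq_eq minus_minus)
    ultimately have "?x + ?x + ?x = 0" by (metis add.assoc)
    then have "?x = 0" by (rule sdpoly_triple_cancel)
    with \<open>?x + ?y = 0\<close> have "D (D (pcoeff R m)) = 0" by simp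
    then have "D (pcoeff R m) = 0" by (rule D_aug_eq_0_imp_eq_0) simp
    then have "pcoeff R m = 0" using aug by (rule D_aug_eq_0_imp_eq_0)
    with m(3) show ?thesis by simp
  next
    case False
    \<comment> \<open>For odd \<open>m\<close> the leading coefficient is odd, so r - grad r = 2 r
      already at order m + 3.\<close>
    have "pcoeff R m + pcoeff R m = 0"
      using eq[of "m + 3"] m(2) False by (simp add: gr ord_le_def D_lin grad_lin)
    with m(3) show ?thesis using sdpoly_double_cancel by blast
  qed
qed

section \<open>The Lax pair\<close>

text \<open>As rewrite rules, this and the following lemmas bring products of generators into
  increasing order and delete repeated odd ones, so that polynomial identities become comparisons of
  normal forms.\<close>

lemma gen_swap:
  "j < i \<Longrightarrow> gen i * gen j = (if even i \<and> even j then - 1 else 1) \<cdot> (gen j * gen i :: 'k::comm_ring_1 sdpoly)"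
  using homogeneous_commute[OF part_gen, of i "gen j :: 'k sdpoly"]
  by (auto simp: grad_gen times_linear)

lemma gen_swap_left:
  "j < i \<Longrightarrow> gen i * (gen j * f) = (if even i \<and> even j then - 1 else 1) \<cdot> (gen j * (gen i * f) :: 'k::comm_ring_1 sdpoly)"
  by (simp add: gen_swap times_linear flip: mult.assoc)

lemma gen_square: "even i \<Longrightarrow> gen i * gen i = (0 :: 'k::field_char_0 sdpoly)"
proof -
  assume "even i"
  have "gen i * gen i = (gradn (Suc i) (gen i) * gen i :: 'k sdpoly)"
    by (rule homogeneous_commute[OF part_gen])
  also have "\<dots> = - (gen i * gen i)" using \<open>even i\<close> by (simp add: grad_gen times_linear)
  finally have "gen i * gen i = (- (gen i * gen i) :: 'k sdpoly)" .
  then have "gen i * gen i + gen i * gen i = (0 :: 'k sdpoly)" by (rule eq_neg_iff_add_eq_0[THEN iffD1])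
  then show "gen i * gen i = (0 :: 'k sdpoly)" by (rule sdpoly_double_cancel)
qed

lemma gen_square_left: "even i \<Longrightarrow> gen i * (gen i * f) = (0 :: 'k::field_char_0 sdpoly)"
  by (simp add: gen_square flip: mult.assoc)

lemma funpow_D_gen: "(D ^^ r) (gen k) = gen (k + r)"
  by (induction r) simp_all

lemma sbinom_numeral:
  "sbinom (numeral m) r = (if even (numeral m :: nat) \<and> odd r then 0 else of_nat (numeral m div 2 choose (r div 2)))"
  using sbinom_int[of "numeral m" r] by (simp only: of_nat_numeral)

lemma sbinom_0_1:
  "sbinom 0 r = (if r = 0 then 1 else 0)" "sbinom 1 r = (if r \<le> 1 then 1 else 0)"
proof -
  have "r div 2 = 0 \<longleftrightarrow> r \<le> 1" by auto
  then show "sbinom 0 r = (if r = 0 then 1 else 0)" "sbinom 1 r = (if r \<le> 1 then 1 else 0)"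
    by (auto simp: sbinom_def gbinomial_0_left le_Suc_eq)
qed

lemma choose_table:
  "(5 :: nat) choose 2 = 10" "(5 :: nat) choose 3 = 10" "(5 :: nat) choose 4 = 5" "(3 :: nat) choose 2 = 3"
  by (simp_all add: eval_nat_numeral)

text \<open>The coefficients of \<open>9 (\<Lambda>\<^sup>1\<^sup>0)\<^sub>+\<close>, obtained by expanding \<open>\<Lambda>\<close> down to \<open>\<D>\<^sup>-\<^sup>9\<close>.\<close>

definition lax_B :: "'k::field_char_0 psdo" where
  "lax_B = fop (9 \<cdot> 1) * Dop 10 + fop (15 \<cdot> gen 1) * Dop 6 + fop (- 15 \<cdot> gen 2) * Dop 5
     + fop (30 \<cdot> gen 3) * Dop 4 + fop (- 15 \<cdot> gen 4) * Dop 3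
     + fop (5 \<cdot> (gen 1 * gen 1) + 25 \<cdot> gen 5) * Dop 2
     + fop (- 10 \<cdot> (gen 6 + gen 1 * gen 2)) * Dop 1 + fop (10 \<cdot> (gen 1 * gen 3 + gen 7)) * Dop 0"

lemma pcoeff_lax_B:
  "pcoeff lax_B k = (if k = 10 then 9 \<cdot> 1 else if k = 6 then 15 \<cdot> gen 1 else if k = 5 then - 15 \<cdot> gen 2
     else if k = 4 then 30 \<cdot> gen 3 else if k = 3 then - 15 \<cdot> gen 4
     else if k = 2 then 5 \<cdot> (gen 1 * gen 1) + 25 \<cdot> gen 5
     else if k = 1 then - 10 \<cdot> (gen 6 + gen 1 * gen 2)
     else if k = 0 then 10 \<cdot> (gen 1 * gen 3 + gen 7) else 0)"
  by (simp add: lax_B_def pcoeff_fop_Dop del: scal_simps)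

lemma pgrad_lax_B: "pgrad lax_B = lax_B"
  by (rule psdo_eqI) (simp add: pgrad.rep_eq pcoeff_lax_B grad_lin grad_gen grad_mult times_linear)

lemma pcoeff_lax_B_phi:
  fixes n :: int
  shows "pcoeff (lax_B * fop \<phi>) n = (\<Sum>k\<in>{0,1,2,3,4,5,6,10}. pcoeff lax_B k * (if n \<le> k then
     sbinom k (nat (k - n)) \<cdot> (if even n then id else grad) (gen (nat (k - n)) :: 'k::field_char_0 sdpoly) else 0))"
proof -
  have e: "lax_B = (\<Sum>k\<in>{0,1,2,3,4,5,6,10}. fop (pcoeff lax_B k) * Dop k :: 'k psdo)"
    by (simp add: pcoeff_lax_B) (simp add: lax_B_def add_ac)
  have "lax_B * fop \<phi> = (\<Sum>k\<in>{0,1,2,3,4,5,6,10}. fop (pcoeff lax_B k) * (Dop k * fop \<phi>) :: 'k psdo)"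
    by (subst e) (simp only: sum_distrib_right mult.assoc)
  then show ?thesis
    by (simp only: pcoeff_sum pcoeff_fop_times pcoeff_Dop_fop funpow_D_gen add_0)
qed

lemma sdpoly_eq_iff: "f = g \<longleftrightarrow> (\<forall>m. mcoeff f m = mcoeff g m)"
  by (metis sdpoly_eqI)

text \<open>The right-hand side is the value of \<phi>_t prescribed by the equation:
  \<open>gen (2 * i)\<close> is the i-th x-derivative of \<phi> and \<open>gen (2 * i + 1)\<close>
  that of \<open>D \<phi>\<close>.\<close>

lemma commutator_lax_B:
  "lax_B * lax_sqrt - lax_sqrt * lax_B = (fop (- (gen 10 + 5 \<cdot> (gen 1 * gen 6)
     + 5 \<cdot> (gen 3 * gen 4) + 5 \<cdot> (gen 1 * (gen 1 * gen 2)))) :: 'k::field_char_0 psdo)"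
proof (rule psdo_eqI)
  fix n :: int
  have gen_2: "gen (Suc (Suc 0)) = (gen 2 :: 'k sdpoly)" by (simp add: numeral_2_eq_2)
  note S = pcoeff_lax_B pcoeff_lax_B_phi sbinom_numeral sbinom_0_1 choose_table fop.rep_eq
     D_lin grad_lin D_mult grad_mult grad_gen gen_swap gen_swap_left gen_square gen_square_left times_linear mult.assoc
  \<comment> \<open>The products have order 13 = 10 + 3 and no negative powers, which leaves
    fourteen explicit coefficient identities.\<close>
  consider "n < 0" | "n \<in> {0..13}" | "13 < n" by force
  then show "pcoeff (lax_B * lax_sqrt - lax_sqrt * lax_B) n = pcoeff (fop (- (gen 10 + 5 \<cdot> (gen 1 * gen 6)
     + 5 \<cdot> (gen 3 * gen 4) + 5 \<cdot> (gen 1 * (gen 1 * gen 2)))) :: 'k psdo) n"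
  proof cases
    case 1
    have "sbinom k (nat (k - n)) = (0 :: 'k)" if "0 \<le> k" for k
      using sbinom_eq_0[of "nat k" "nat (k - n)"] 1 that by simp
    then have "pcoeff (lax_B * fop \<phi> :: 'k psdo) n = 0"
      unfolding pcoeff_lax_B_phi by (intro sum.neutral ballI) (auto simp del: diff_0)
    with 1 show ?thesis
      unfolding commutator_lax_sqrt by (simp add: pcoeff_lax_B fop.rep_eq D_lin grad_lin)
  next
    case 2
    then have "0 \<le> n" "n \<le> 13" by simp_all
    then have "n = 0 \<or> n = 1 \<or> n = 2 \<or> n = 3 \<or> n = 4 \<or> n = 5 \<or> n = 6 \<or> n = 7 \<or> n = 8 \<or> n = 9 \<or> n = 10 \<or> n = 11 \<or> n = 12 \<or> n = 13"
      by presburger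
    then show ?thesis
      unfolding commutator_lax_sqrt
      by (elim disjE) (simp_all add: S gen_2, simp_all add: sdpoly_eq_iff algebra_simps)
  next
    case 3
    then show ?thesis unfolding commutator_lax_sqrt by (simp add: S)
  qed
qed

lemma pcoeff_of_nat_times: "pcoeff (of_nat m * P) k = of_nat m \<cdot> pcoeff P k"
  by (induction m) (simp_all add: distrib_right)

lemma pcoeff_numeral_times: "pcoeff (numeral m * P) k = numeral m \<cdot> pcoeff P k"
  using pcoeff_of_nat_times[of "numeral m" P k] by simp

lemma pgrad_numeral: "pgrad (numeral m) = numeral m"
proof -
  have "pgrad (of_nat n) = (of_nat n :: 'a psdo)" for n by (induction n) simp_all
  from this[of "numeral m"] show ?thesis by simp
qed

lemma numeral_times_sdpoly: "numeral m * f = numeral m \<cdot> (f :: 'k::comm_ring_1 sdpoly)"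
proof -
  have "of_nat n * f = of_nat n \<cdot> f" for n
    by (induction n) (simp_all add: distrib_right)
  from this[of "numeral m"] show ?thesis by simp
qed

lemma lax_root_10_plus_part: "9 * plus_part (lax_root ^ 10) = lax_B"
proof -
  let ?S = "lax_sqrt :: 'a psdo" and ?P = "lax_root ^ 10 :: 'a psdo"
  define R where "R = 9 * ?P - lax_B"
  have "pgrad ?P = ?P"
    by (simp add: pgrad_power lax_root(3))
  then have even: "pgrad R = R" by (simp add: R_def pgrad_lax_B pgrad_mult pgrad_numeral)
  \<comment> \<open>The constant 9 at order 10 cancels; every other coefficient of
    \<open>lax_B\<close> contains a generator.\<close>
  have aug: "aug (pcoeff R k) = 0" for k
    by (simp add: R_def pcoeff_numeral_times aug_lin aug_lax_root_power pcoeff_lax_B aug_mult)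
  have "?S * (9 * ?P) = 9 * (?S * ?P)"
    using mult_of_nat_commute[of 9 ?S] by (simp flip: mult.assoc)
  \<comment> \<open>Powers of the root commute with their cube \<open>?S\<close>, so only
    \<open>lax_B\<close> contributes, and its commutator is a function.\<close>
  then have "R * ?S - ?S * R = - (lax_B * ?S - ?S * lax_B)"
    using lax_root_power_commute[of 10, where 'a='a] by (simp add: R_def algebra_simps)
  then have "ord_le (R * ?S - ?S * R) 0"
    unfolding commutator_lax_B by (simp add: ord_le_def fop.rep_eq)
  with even aug have R: "ord_le R (- 1)" by (rule commutator_lax_sqrt_ord_le_0)
  show ?thesis
  proof (rule psdo_eqI)
    fix k :: int
    have "9 \<cdot> pcoeff ?P k = pcoeff lax_B k" if "0 \<le> k"
      using R that by (simp add: ord_le_def R_def pcoeff_numeral_times)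
    then show "pcoeff (9 * plus_part ?P) k = pcoeff lax_B k"
      by (auto simp: pcoeff_numeral_times plus_part.rep_eq pcoeff_lax_B)
  qed
qed

section \<open>The flow on powers of the root\<close>

lemma funpow_dx_gen: "((\<lambda>f. D (D f)) ^^ m) (gen k) = gen (k + 2 * m)"
  by (induction m) simp_all

lemma even_derivation_grad: "even_derivation d \<Longrightarrow> d (grad f) = grad (d f)"
  by (simp add: even_derivation_def grad_def linear_sdD)

lemma lax_root_flow:
  fixes dt :: "'k::field_char_0 sdpoly \<Rightarrow> 'k sdpoly"
  assumes dt: "even_derivation dt" "\<forall>f. dt (D f) = D (dt f)"
    and flow: "dt \<phi> + (dx ^^ 5) \<phi> + 5 * (dx ^^ 3) \<phi> * D \<phi> + 5 * (dx ^^ 2) \<phi> * D (dx \<phi>)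
           + 5 * dx \<phi> * (D \<phi>)^2 = 0"
  shows "pmap dt (lax_root ^ n) = lax_B * lax_root ^ n - lax_root ^ n * lax_B"
proof -
  let ?L = "lax_root :: 'k psdo" and ?S = "lax_sqrt :: 'k psdo"
  have lin: "linear_sd dt" and mult: "\<And>f g. dt (f * g) = dt f * g + f * dt g"
    using dt(1) by (simp_all add: even_derivation_def)
  have pmult: "pmap dt (P * Q) = pmap dt P * Q + P * pmap dt Q" for P Q
    by (rule pmap_derivation[OF lin _ even_derivation_grad[OF dt(1)] mult]) (simp add: dt(2))
  have one: "dt 1 = 0" using mult[of 1 1] by simp
  have "dt \<phi> + (gen 10 + 5 \<cdot> (gen 1 * gen 6) + 5 \<cdot> (gen 3 * gen 4) + 5 \<cdot> (gen 1 * (gen 1 * gen 2))) = 0"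
    using flow
    by (simp add: funpow_dx_gen numeral_times_sdpoly times_linear gen_swap power2_eq_square mult.assoc gen_swap_left
        add.assoc numeral_2_eq_2[symmetric] numeral_3_eq_3[symmetric])
  then have "dt \<phi> = - (gen 10 + 5 \<cdot> (gen 1 * gen 6) + 5 \<cdot> (gen 3 * gen 4) + 5 \<cdot> (gen 1 * (gen 1 * gen 2)))"
    by (rule eq_neg_iff_add_eq_0[THEN iffD2])
  then have "pmap dt ?S = lax_B * ?S - ?S * lax_B"
    unfolding commutator_lax_B
    by (intro psdo_eqI) (simp add: pcoeff_pmap[OF lin] lax_sqrt_def Dop.rep_eq fop.rep_eq one linear_sdD[OF lin])
  moreover have "?S = ?L * ?L * ?L" by (simp only: lax_root(2)[symmetric] power3_eq_cube)
  ultimately have cube: "pmap dt (?L * ?L * ?L) = lax_B * (?L * ?L * ?L) - ?L * ?L * ?L * lax_B" by simp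
  \<comment> \<open>The time derivative and the commutator with \<open>lax_B\<close> are both
    derivations. Their difference \<open>X\<close> on the root therefore produces the linearised
    cube of \<open>X\<close> as their difference on \<open>?S\<close>, which is zero.\<close>
  define X where "X = pmap dt ?L - (lax_B * ?L - ?L * lax_B)"
  have "X * ?L * ?L + ?L * X * ?L + ?L * ?L * X = 0"
    using cube by (simp add: X_def pmult algebra_simps)
  then have "X = 0" by (rule cube_variation_eq_0[OF lax_root(1) lax_root(1)])
  then have L: "pmap dt ?L = lax_B * ?L - ?L * lax_B" by (simp add: X_def)
  show ?thesis
  proof (induction n)
    case 0
    have "pmap dt 1 = (0 :: 'k psdo)"
      by (rule psdo_eqI) (simp add: pcoeff_pmap[OF lin] one_psdo_def Dop.rep_eq one linear_sdD[OF lin])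
    then show ?case by simp
  next
    case (Suc n)
    show ?case unfolding power_Suc pmult L Suc by (simp add: algebra_simps)
  qed
qed

theorem mainTheorem3:
  fixes dt :: "'k::field_char_0 sdpoly \<Rightarrow> 'k sdpoly" and n :: nat
  assumes "even_derivation dt"
    and "\<forall>f. dt (D f) = D (dt f)"
    and "dt \<phi> + (dx ^^ 5) \<phi> + 5 * (dx ^^ 3) \<phi> * D \<phi> + 5 * (dx ^^ 2) \<phi> * D (dx \<phi>)
           + 5 * dx \<phi> * (D \<phi>)^2 = 0"
    and "n \<ge> 1"
  shows "pmap dt (lax_root_pow n) = scomm (9 * plus_part (lax_root_pow 10)) (lax_root_pow n)
    \<and> dt (sres (lax_root_pow n)) \<in> range D
    \<and> (\<forall>J. formal_integral J \<longrightarrow> J (dt (sres (lax_root_pow n))) = 0)"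
proof -
  let ?L = "lax_root ^ n :: 'k psdo"
  have even: "ppart 0 (lax_B :: 'k psdo) = lax_B" by (simp add: ppart_eq_iff pgrad_lax_B)
  have diff: "plus_part (lax_B :: 'k psdo) = lax_B"
    by (rule psdo_eqI) (simp add: plus_part.rep_eq pcoeff_lax_B)
  have flow: "pmap dt ?L = lax_B * ?L - ?L * lax_B"
    using lax_root_flow assms(1-3) .
  have "linear_sd dt" using assms(1) by (simp add: even_derivation_def)
  then have "dt (sres ?L) = sres (lax_B * ?L - ?L * lax_B)"
    by (simp only: sres_def pcoeff_pmap flow[symmetric])
  then have "dt (sres ?L) \<in> range D"
    using sres_commutator_differential[OF diff even] by simp
  then show ?thesis
    using flow by (auto simp: lax_root_pow_def lax_root_10_plus_part scomm_even[OF even] formal_integral_def)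
qed

end
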